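(* Let $\mathbb{K}$ be a field and let $I\subset S=\mathbb{K}[x_1,x_2]$ be a non-zero monomial ideal. Then $\operatorname{reg}(\overline{I})\le \operatorname{reg}(I)$.
   Context: $S$ carries the standard grading ($\deg x_i=1$). For an ideal $I$, $\overline{I}$ denotes its integral closure in $S$. For a finitely generated graded $S$-module $M$, $\operatorname{reg}(M)$ is the Castelnuovo–Mumford regularity, $\operatorname{reg}(M)=\max\{j-i\mid \beta_{i,j}(M)\neq 0\}$, where $\beta_{i,j}(M)$ are the graded Betti numbers of the minimal graded free resolution of $M$ over $S$; $\operatorname{reg}(I)$ is the regularity of $I$ viewed as a graded $S$-module. *)

theory Defs
  imports Complex_Main "HOL-Library.Poly_Mapping" "HOL-Library.Product_Plus"
begin

text \<open>The ring \<open>S = K[x\<^sub>1, x\<^sub>2]\<close>: the exponent pair \<open>(i, j)\<close> stands for \<open>x\<^sub>1 ^ i * x\<^sub>2 ^ j\<close>.\<close>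

type_synonym 'k poly2 = "(nat \<times> nat) \<Rightarrow>\<^sub>0 'k"

definition monom2 :: "nat \<times> nat \<Rightarrow> 'k::field poly2" where
  "monom2 e = Poly_Mapping.single e 1"

text \<open>The homogeneous part of degree \<open>d\<close> of \<open>S\<close>; it is zero for negative \<open>d\<close>.\<close>

definition homogeneous_part :: "int \<Rightarrow> 'k::field poly2 set" where
  "homogeneous_part d = {f. \<forall>e \<in> Poly_Mapping.keys f. int (fst e + snd e) = d}"

text \<open>Ideals of \<open>S\<close> are the submodules of \<open>S\<close> over itself, i.e. of the module with
  scalar multiplication \<^term>\<open>(*)\<close>.\<close>

definition monomial_ideal :: "'k::field poly2 set \<Rightarrow> bool" where
  "monomial_ideal I \<longleftrightarrow> (\<exists>E. I = module.span (*) (monom2 ` E))"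

definition irrelevant_ideal :: "'k::field poly2 set" where
  "irrelevant_ideal = module.span (*) {monom2 (1, 0), monom2 (0, 1)}"

primrec ideal_power :: "'k::field poly2 set \<Rightarrow> nat \<Rightarrow> 'k poly2 set" where
  "ideal_power I 0 = UNIV"
| "ideal_power I (Suc n) = module.span (*) {f * g | f g. f \<in> I \<and> g \<in> ideal_power I n}"

definition ideal_integral_closure :: "'k::field poly2 set \<Rightarrow> 'k poly2 set" where
  "ideal_integral_closure I =
     {f. \<exists>n a. 0 < n \<and> (\<forall>k \<in> {1..n}. a k \<in> ideal_power I k) \<and>
           f ^ n + (\<Sum>k = 1..n. a k * f ^ (n - k)) = 0}"

text \<open>Graded free modules of finite rank. A list \<open>as\<close> of integers encodes the module
  \<open>S(-as ! 0) \<oplus> \<dots> \<oplus> S(-as ! (length as - 1))\<close>, whose elements are the vectors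
  supported on \<open>{..<length as}\<close>.\<close>

definition vec_scale :: "'k::field poly2 \<Rightarrow> (nat \<Rightarrow>\<^sub>0 'k poly2) \<Rightarrow> (nat \<Rightarrow>\<^sub>0 'k poly2)" where
  "vec_scale c v = Poly_Mapping.map ((*) c) v"

definition free_module :: "int list \<Rightarrow> (nat \<Rightarrow>\<^sub>0 'k::field poly2) set" where
  "free_module as = {v. Poly_Mapping.keys v \<subseteq> {..<length as}}"

definition free_part :: "int list \<Rightarrow> int \<Rightarrow> (nat \<Rightarrow>\<^sub>0 'k::field poly2) set" where
  "free_part as d =
     {v \<in> free_module as. \<forall>k < length as. Poly_Mapping.lookup v k \<in> homogeneous_part (d - as ! k)}"

text \<open>A graded \<open>S\<close>-module \<open>M\<close> with homogeneous parts \<open>G d\<close>.\<close>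

locale graded_module = module scale
  for scale :: "'k::field poly2 \<Rightarrow> 'm::ab_group_add \<Rightarrow> 'm" +
  fixes M :: "'m set" and G :: "int \<Rightarrow> 'm set"
  assumes subspace_carrier: "subspace M"
    and part_subset: "G d \<subseteq> M"
    and zero_in_part: "0 \<in> G d"
    and diff_in_part: "x \<in> G d \<Longrightarrow> y \<in> G d \<Longrightarrow> x - y \<in> G d"
    and scale_part: "f \<in> homogeneous_part c \<Longrightarrow> x \<in> G d \<Longrightarrow> scale f x \<in> G (c + d)"
    and direct_sum: "x \<in> M \<Longrightarrow>
      \<exists>!u :: int \<Rightarrow>\<^sub>0 'm. (\<forall>d. Poly_Mapping.lookup u d \<in> G d) \<and>
        x = (\<Sum>d \<in> Poly_Mapping.keys u. Poly_Mapping.lookup u d)"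
begin

text \<open>A minimal graded free resolution
  \<open>\<dots> \<rightarrow> F\<^sub>2 \<rightarrow> F\<^sub>1 \<rightarrow> F\<^sub>0 \<rightarrow> M \<rightarrow> 0\<close>, where \<open>F\<^sub>i\<close> is encoded by
  the list \<open>as i\<close>, the map \<open>F\<^sub>i\<^sub>+\<^sub>1 \<rightarrow> F\<^sub>i\<close> is \<open>\<phi> i\<close> and the augmentation is
  \<open>\<epsilon>\<close>. The maps are linear on all finitely supported vectors, which is no restriction since a
  linear map on \<open>F\<^sub>i\<close> extends by zero on the remaining basis vectors; only their restrictions
  to \<open>F\<^sub>i\<close> matter. Minimality says that the image of \<open>F\<^sub>i\<^sub>+\<^sub>1\<close> lies in
  \<open>(x\<^sub>1, x\<^sub>2) F\<^sub>i\<close>.\<close>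

definition minimal_graded_free_resolution ::
  "(nat \<Rightarrow> int list) \<Rightarrow> ((nat \<Rightarrow>\<^sub>0 'k poly2) \<Rightarrow> 'm) \<Rightarrow>
   (nat \<Rightarrow> (nat \<Rightarrow>\<^sub>0 'k poly2) \<Rightarrow> (nat \<Rightarrow>\<^sub>0 'k poly2)) \<Rightarrow> bool" where
  "minimal_graded_free_resolution as \<epsilon> \<phi> \<longleftrightarrow>
     module_hom vec_scale scale \<epsilon> \<and>
     (\<forall>i. module_hom vec_scale vec_scale (\<phi> i)) \<and>
     (\<forall>d. \<epsilon> ` free_part (as 0) d \<subseteq> G d) \<and>
     (\<forall>i d. \<phi> i ` free_part (as (Suc i)) d \<subseteq> free_part (as i) d) \<and>
     \<epsilon> ` free_module (as 0) = M \<and>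
     {v \<in> free_module (as 0). \<epsilon> v = 0} = \<phi> 0 ` free_module (as 1) \<and>
     (\<forall>i. {v \<in> free_module (as (Suc i)). \<phi> i v = 0} = \<phi> (Suc i) ` free_module (as (Suc (Suc i)))) \<and>
     (\<forall>i. \<forall>v \<in> free_module (as (Suc i)). \<forall>k. Poly_Mapping.lookup (\<phi> i v) k \<in> irrelevant_ideal)"

text \<open>The number of summands \<open>S(-j)\<close> in step \<open>i\<close> of the minimal graded free resolution. The
  resolution of a finitely generated graded module is unique up to isomorphism, so the choice made
  by \<open>SOME\<close> is immaterial.\<close>

definition graded_betti :: "nat \<Rightarrow> int \<Rightarrow> nat" where
  "graded_betti i j =
     count_list ((SOME as. \<exists>\<epsilon> \<phi>. minimal_graded_free_resolution as \<epsilon> \<phi>) i) j"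

definition regularity :: int where
  "regularity = Max {j - int i | i j. graded_betti i j \<noteq> 0}"

end

definition ideal_regularity :: "'k::field poly2 set \<Rightarrow> int" where
  "ideal_regularity I = graded_module.regularity (*) I (\<lambda>d. I \<inter> homogeneous_part d)"

end

theory Submission
  imports Defs
begin

text \<open>For a monomial ideal \<open>I\<close> with exponent set \<open>A\<close>, chasing a minimal resolution through the Koszul
  relations of \<open>x\<^sub>1, x\<^sub>2\<close> shows that \<open>\<beta>\<^sub>0\<close> lives in the degrees of the minimal generators and \<open>\<beta>\<^sub>1\<close> in
  the degrees \<open>deg w + 2\<close>, where \<open>w\<close> runs through the corners of \<open>A\<close> (the socle of \<open>S / I\<close>); such a
  resolution exists by the Hilbert--Burch relations between consecutive generators of the staircase.
  The integral closure is the monomial ideal of the lattice points \<open>B\<close> of the Newton polygon, and \<open>A\<close>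
  and \<open>B\<close> have the same minimal first and second coordinates. A corner of \<open>B\<close> is not in \<open>A\<close>, so
  increasing it leads to a corner of \<open>A\<close> of at least the same degree, and the generators of \<open>B\<close> are
  handled in the same way.\<close>

section \<open>Monomials and monomial ideals\<close>

text \<open>\<open>regularity\<close> refers to a resolution picked by \<open>SOME\<close>, so
  degrees cannot simply be read off one convenient resolution. The chase compares Tor with Koszul
  homology by hand and determines the set of degrees in any minimal resolution; the maximum depends
  only on that set. The staircase resolution ensures that \<open>SOME\<close> chooses something. The
  shift by 2 is the degree of the Koszul relation x (y w) - y (x w) = 0.

  The description of the integral closure takes two arguments. An exponent outside the Newton
  polygon is separated from it by a linear form with strictly positive coefficients; for this weight
  \<open>f ^ n\<close> alone would reach the lowest weight in an integral equation. Conversely, f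
  with support in the polygon maps V into I V, where V is the monomial ideal of the polygon dilated
  by the number g of generators: g + 1 units spread over g points leave at least one unit on some
  point, so a generator splits off. A Cayley-Hamilton argument on V then yields the integral
  equation.\<close>

lemma module_mult: "module ((*) :: 'a::comm_ring_1 \<Rightarrow> 'a \<Rightarrow> 'a)"
  by standard (simp_all add: algebra_simps)

abbreviation is_ideal :: "'a::comm_ring_1 set \<Rightarrow> bool" where
  "is_ideal \<equiv> module.subspace (*)"

lemmas is_ideal_def = module.subspace_def[OF module_mult]
lemmas is_ideal_diff = module.subspace_diff[OF module_mult]
lemmas is_ideal_sum = module.subspace_sum[OF module_mult]
lemmas is_ideal_span = module.subspace_span[OF module_mult]
lemmas ideal_span_base = module.span_base[OF module_mult]
lemmas ideal_span_minimal = module.span_minimal[OF module_mult]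

lemma poly_mapping_sum_single:
  "p = (\<Sum>k\<in>Poly_Mapping.keys p. Poly_Mapping.single k (Poly_Mapping.lookup p k))"
proof (rule poly_mapping_eqI)
  fix k
  have "Poly_Mapping.lookup (\<Sum>k\<in>Poly_Mapping.keys p. Poly_Mapping.single k (Poly_Mapping.lookup p k)) k
    = (\<Sum>i\<in>Poly_Mapping.keys p. if i = k then Poly_Mapping.lookup p k else 0)"
    unfolding lookup_sum by (rule sum.cong) (auto simp: lookup_single when_def)
  also have "\<dots> = Poly_Mapping.lookup p k"
    by (simp add: in_keys_iff)
  finally show "Poly_Mapping.lookup p k =
    Poly_Mapping.lookup (\<Sum>k\<in>Poly_Mapping.keys p. Poly_Mapping.single k (Poly_Mapping.lookup p k)) k" ..
qed

lemma lookup_monom2_mult_add [simp]: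
  "Poly_Mapping.lookup (monom2 e * p) (e + u) = Poly_Mapping.lookup p u"
proof -
  have "monom2 e * p = (\<Sum>k\<in>Poly_Mapping.keys p. Poly_Mapping.single (e + k) (Poly_Mapping.lookup p k))"
    by (subst (1) poly_mapping_sum_single[of p]) (simp add: monom2_def sum_distrib_left mult_single)
  then have "Poly_Mapping.lookup (monom2 e * p) (e + u)
    = (\<Sum>k\<in>Poly_Mapping.keys p. if k = u then Poly_Mapping.lookup p u else 0)"
    unfolding lookup_sum by (auto simp: lookup_sum lookup_single when_def intro!: sum.cong)
  also have "\<dots> = Poly_Mapping.lookup p u"
    by (simp add: in_keys_iff)
  finally show ?thesis .
qed

lemma keys_monom2_mult:
  fixes p :: "'a::field poly2"
  shows "Poly_Mapping.keys (monom2 e * p) = (+) e ` Poly_Mapping.keys p"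
proof
  show "Poly_Mapping.keys (monom2 e * p) \<subseteq> (+) e ` Poly_Mapping.keys p"
  proof
    fix k assume "k \<in> Poly_Mapping.keys (monom2 e * p)"
    then obtain a b where "k = a + b" "a \<in> Poly_Mapping.keys (monom2 e :: 'a poly2)" "b \<in> Poly_Mapping.keys p"
      using keys_mult[of "monom2 e" p] by blast
    then show "k \<in> (+) e ` Poly_Mapping.keys p" by (simp add: monom2_def)
  qed
  show "(+) e ` Poly_Mapping.keys p \<subseteq> Poly_Mapping.keys (monom2 e * p)"
    by (auto simp: in_keys_iff)
qed

lemma keys_monom2 [simp]: "Poly_Mapping.keys (monom2 e :: 'k::field poly2) = {e}"
  by (simp add: monom2_def)

lemma monom2_mult: "monom2 a * monom2 b = monom2 (a + b)"
  by (simp add: monom2_def mult_single)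

lemma monom2_mult_eq_zero_iff [simp]: "monom2 e * p = 0 \<longleftrightarrow> p = 0"
proof
  assume "monom2 e * p = 0"
  then have "Poly_Mapping.lookup p u = 0" for u
    by (metis lookup_monom2_mult_add lookup_zero)
  then show "p = 0" by (intro poly_mapping_eqI) simp
qed simp

lemma mult_monom2_eq_zero_iff [simp]: "p * monom2 e = 0 \<longleftrightarrow> p = 0"
  by (simp add: mult.commute[of p])

lemma monom2_mult_cancel [simp]: "monom2 e * p = monom2 e * q \<longleftrightarrow> p = q"
  using monom2_mult_eq_zero_iff[of e "p - q"] by (simp add: algebra_simps)

text \<open>Division by the monomial with exponent \<open>e\<close>. Terms not divisible by it are
  dropped, so the operation is total, and it is exact once all keys lie in
  \<open>range ((+) e)\<close>.\<close>

definition shift :: "nat \<times> nat \<Rightarrow> 'k::field poly2 \<Rightarrow> 'k poly2" where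
  "shift e p = Poly_Mapping.map_key ((+) e) p"

lemma lookup_shift: "Poly_Mapping.lookup (shift e p) u = Poly_Mapping.lookup p (e + u)"
  by (simp add: shift_def map_key.rep_eq)

lemma shift_zero [simp]: "shift e 0 = 0"
  by (rule poly_mapping_eqI) (simp add: lookup_shift)

lemma monom2_mult_shift:
  assumes "Poly_Mapping.keys p \<subseteq> range ((+) e)"
  shows "monom2 e * shift e p = p"
proof (rule poly_mapping_eqI)
  fix k
  show "Poly_Mapping.lookup (monom2 e * shift e p) k = Poly_Mapping.lookup p k"
  proof (cases "k \<in> range ((+) e)")
    case True
    then show ?thesis by (auto simp: lookup_shift)
  next
    case False
    with assms have "k \<notin> Poly_Mapping.keys p" "k \<notin> Poly_Mapping.keys (monom2 e * shift e p)"
      by (auto simp: keys_monom2_mult)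
    then show ?thesis by (simp add: in_keys_iff)
  qed
qed

lemma range_plus_pair: "range ((+) (a, b)) = {u::nat \<times> nat. a \<le> fst u \<and> b \<le> snd u}"
proof (intro set_eqI iffI)
  fix u :: "nat \<times> nat" assume "u \<in> {u. a \<le> fst u \<and> b \<le> snd u}"
  then have "u = (a, b) + (fst u - a, snd u - b)" by (auto simp: prod_eq_iff)
  then show "u \<in> range ((+) (a, b))" by blast
qed auto

text \<open>Powers of the two variables form a regular sequence: multiplication by a power of x
  leaves second coordinates unchanged, so the power of y visible on the other side must already
  divide \<open>p\<close>.\<close>

lemma monomial_koszul:
  assumes "monom2 (a, 0) * p + monom2 (0, b) * q = 0"
  shows "p = monom2 (0, b) * shift (0, b) p" and "q = - monom2 (a, 0) * shift (0, b) p"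
proof -
  have eq: "monom2 (a, 0) * p = monom2 (0, b) * (- q)"
    using assms by (simp add: eq_neg_iff_add_eq_0)
  have "Poly_Mapping.keys p \<subseteq> range ((+) (0, b))"
  proof
    fix u assume "u \<in> Poly_Mapping.keys p"
    then have "(a, 0) + u \<in> Poly_Mapping.keys (monom2 (0, b) * (- q))"
      unfolding eq[symmetric] by (simp add: keys_monom2_mult)
    then obtain t where "(a, 0) + u = (0, b) + t" by (auto simp: keys_monom2_mult)
    then have "b \<le> snd u" by (metis le_add1 snd_add snd_conv add_0)
    then show "u \<in> range ((+) (0, b))" by (simp add: range_plus_pair)
  qed
  from monom2_mult_shift[OF this] show p: "p = monom2 (0, b) * shift (0, b) p" by simp
  have "monom2 (0, b) * (monom2 (a, 0) * shift (0, b) p + q) = 0"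
    using assms p by (metis (no_types, lifting) distrib_left mult.left_commute)
  then show "q = - monom2 (a, 0) * shift (0, b) p"
    by (simp add: add_eq_0_iff)
qed

section \<open>Monomial ideals as up-closed sets of exponents\<close>

definition up_closed :: "(nat \<times> nat) set \<Rightarrow> bool" where
  "up_closed A \<longleftrightarrow> (\<forall>a\<in>A. \<forall>u. a + u \<in> A)"

definition mon_ideal :: "(nat \<times> nat) set \<Rightarrow> 'k::field poly2 set" where
  "mon_ideal A = {f. Poly_Mapping.keys f \<subseteq> A}"

lemma up_closedD: "up_closed A \<Longrightarrow> a \<in> A \<Longrightarrow> fst a \<le> fst e \<Longrightarrow> snd a \<le> snd e \<Longrightarrow> e \<in> A"
proof -
  assume "up_closed A" "a \<in> A" "fst a \<le> fst e" "snd a \<le> snd e"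
  then have "e \<in> range ((+) a)" using range_plus_pair[of "fst a" "snd a"] by simp
  then show ?thesis using \<open>up_closed A\<close> \<open>a \<in> A\<close> unfolding up_closed_def by blast
qed

lemma up_closed_multiples: "up_closed {e + u | e u. e \<in> E}"
  unfolding up_closed_def by (smt (verit) add.assoc mem_Collect_eq)

lemma monom2_in_mon_ideal [simp]: "monom2 e \<in> mon_ideal A \<longleftrightarrow> e \<in> A"
  by (simp add: mon_ideal_def)

lemma mon_ideal_is_ideal:
  assumes "up_closed A"
  shows "is_ideal (mon_ideal A :: 'k::field poly2 set)"
proof -
  have "c * x \<in> mon_ideal A" if "x \<in> mon_ideal A" for c x :: "'k poly2"
  proof -
    have *: "a + b \<in> A" if "b \<in> A" for a b
      using assms that unfolding up_closed_def by (metis add.commute)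
    have "Poly_Mapping.keys x \<subseteq> A" using that by (simp add: mon_ideal_def)
    then have "{a + b | a b. a \<in> Poly_Mapping.keys c \<and> b \<in> Poly_Mapping.keys x} \<subseteq> A"
      using * by blast
    then show ?thesis using keys_mult[of c x] unfolding mon_ideal_def by blast
  qed
  moreover have "x + y \<in> mon_ideal A" if "x \<in> mon_ideal A" "y \<in> mon_ideal A" for x y :: "'k poly2"
    using keys_add[of x y] that by (auto simp: mon_ideal_def)
  ultimately show ?thesis by (auto simp: is_ideal_def mon_ideal_def)
qed

lemma span_monom2:
  "module.span (*) (monom2 ` E) = (mon_ideal {e + u | e u. e \<in> E} :: 'k::field poly2 set)"
proof
  let ?A = "{e + u | e u. e \<in> E}"
  show "module.span (*) (monom2 ` E) \<subseteq> (mon_ideal ?A :: 'k poly2 set)"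
  proof (rule ideal_span_minimal)
    show "monom2 ` E \<subseteq> (mon_ideal ?A :: 'k poly2 set)"
      by auto (metis add.right_neutral)
  qed (rule mon_ideal_is_ideal[OF up_closed_multiples])
  show "mon_ideal ?A \<subseteq> module.span (*) (monom2 ` E :: 'k poly2 set)"
  proof
    fix f :: "'k poly2" assume f: "f \<in> mon_ideal ?A"
    have "(\<Sum>k\<in>Poly_Mapping.keys f. Poly_Mapping.single k (Poly_Mapping.lookup f k))
      \<in> module.span (*) (monom2 ` E)"
    proof (rule is_ideal_sum[OF is_ideal_span])
      fix k assume "k \<in> Poly_Mapping.keys f"
      then obtain e u where k: "k = e + u" "e \<in> E" using f by (auto simp: mon_ideal_def)
      have "Poly_Mapping.single k (Poly_Mapping.lookup f k)
        = Poly_Mapping.single u (Poly_Mapping.lookup f k) * monom2 e"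
        by (simp add: k monom2_def mult_single add.commute)
      also have "\<dots> \<in> module.span (*) (monom2 ` E)"
        using k by (intro module.span_scale[OF module_mult] ideal_span_base imageI)
      finally show "Poly_Mapping.single k (Poly_Mapping.lookup f k) \<in> module.span (*) (monom2 ` E)" .
    qed
    then show "f \<in> module.span (*) (monom2 ` E)"
      using poly_mapping_sum_single[of f] by simp
  qed
qed

lemma monomial_idealE:
  assumes "monomial_ideal I"
  obtains A where "up_closed A" "I = mon_ideal A"
proof -
  from assms obtain E where "I = module.span (*) (monom2 ` E)" by (auto simp: monomial_ideal_def)
  then show ?thesis using that span_monom2 up_closed_multiples by blast
qed

text \<open>A nonzero exponent has a positive coordinate, so its monomial is a multiple of x or y.
  Minimality of a resolution thus becomes a statement about constant terms.\<close>

lemma irrelevant_ideal_iff: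
  fixes p :: "'k::field poly2"
  shows "p \<in> irrelevant_ideal \<longleftrightarrow> Poly_Mapping.lookup p 0 = 0"
proof -
  have "{e + u | e u. e \<in> {(1, 0), (0, 1)}} = - {0 :: nat \<times> nat}"
  proof (intro set_eqI iffI)
    fix k :: "nat \<times> nat" assume "k \<in> - {0}"
    then consider "1 \<le> fst k" | "1 \<le> snd k" by (cases k) (auto simp: zero_prod_def)
    then show "k \<in> {e + u | e u. e \<in> {(1, 0), (0, 1)}}"
    proof cases
      case 1
      then have "k \<in> range ((+) (1, 0))" by (simp add: range_plus_pair)
      then show ?thesis by blast
    next
      case 2
      then have "k \<in> range ((+) (0, 1))" by (simp add: range_plus_pair)
      then show ?thesis by blast
    qed
  qed (auto simp: zero_prod_def)
  then have "irrelevant_ideal = (mon_ideal (- {0}) :: 'k poly2 set)"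
    using span_monom2[of "{(1, 0), (0, 1)}"] by (simp add: irrelevant_ideal_def)
  then show ?thesis by (auto simp: mon_ideal_def in_keys_iff)
qed

section \<open>Graded pieces\<close>

definition hom_proj :: "int \<Rightarrow> 'k::field poly2 \<Rightarrow> 'k poly2" where
  "hom_proj d p = Poly_Mapping.mapp (\<lambda>e c. c when int (fst e + snd e) = d) p"

lemma lookup_hom_proj:
  "Poly_Mapping.lookup (hom_proj d p) e = (Poly_Mapping.lookup p e when int (fst e + snd e) = d)"
  by (auto simp: hom_proj_def lookup_mapp when_def in_keys_iff)

lemma keys_hom_proj: "Poly_Mapping.keys (hom_proj d p) = {e \<in> Poly_Mapping.keys p. int (fst e + snd e) = d}"
  by (auto simp: in_keys_iff lookup_hom_proj)

lemma hom_proj_homogeneous [simp]: "hom_proj d p \<in> homogeneous_part d"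
  by (auto simp: homogeneous_part_def keys_hom_proj)

lemma hom_proj_of_homogeneous:
  assumes "p \<in> homogeneous_part d"
  shows "hom_proj d' p = (p when d' = d)"
proof (rule poly_mapping_eqI)
  fix k show "Poly_Mapping.lookup (hom_proj d' p) k = Poly_Mapping.lookup (p when d' = d) k"
    using assms by (cases "k \<in> Poly_Mapping.keys p")
      (auto simp: lookup_hom_proj homogeneous_part_def when_def in_keys_iff)
qed

lemma hom_proj_zero [simp]: "hom_proj d 0 = 0"
  by (rule poly_mapping_eqI) (simp add: lookup_hom_proj)

lemma hom_proj_add: "hom_proj d (p + q) = hom_proj d p + hom_proj d q"
  by (rule poly_mapping_eqI) (simp add: lookup_hom_proj lookup_add when_add_distrib)

lemma hom_proj_sum: "hom_proj d (sum f X) = (\<Sum>x\<in>X. hom_proj d (f x))"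
  by (induction X rule: infinite_finite_induct) (simp_all add: hom_proj_add)

lemma hom_proj_sum_eq:
  assumes "finite D" "\<And>e. e \<in> Poly_Mapping.keys p \<Longrightarrow> int (fst e + snd e) \<in> D"
  shows "(\<Sum>d\<in>D. hom_proj d p) = p"
proof (rule poly_mapping_eqI)
  fix k
  have "Poly_Mapping.lookup (\<Sum>d\<in>D. hom_proj d p) k =
    (\<Sum>d\<in>D. if d = int (fst k + snd k) then Poly_Mapping.lookup p k else 0)"
    unfolding lookup_sum by (rule sum.cong) (auto simp: lookup_hom_proj when_def)
  also have "\<dots> = Poly_Mapping.lookup p k"
    using assms(1) assms(2)[of k] by (auto simp: in_keys_iff simp del: of_nat_add)
  finally show "Poly_Mapping.lookup (\<Sum>d\<in>D. hom_proj d p) k = Poly_Mapping.lookup p k" .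
qed

lemma homogeneous_part_add: "p \<in> homogeneous_part d \<Longrightarrow> q \<in> homogeneous_part d \<Longrightarrow> p + q \<in> homogeneous_part d"
  using keys_add[of p q] by (auto simp: homogeneous_part_def)

lemma homogeneous_part_uminus: "p \<in> homogeneous_part d \<Longrightarrow> - p \<in> homogeneous_part d"
  by (auto simp: homogeneous_part_def in_keys_iff)

lemma homogeneous_part_diff: "p \<in> homogeneous_part d \<Longrightarrow> q \<in> homogeneous_part d \<Longrightarrow> p - q \<in> homogeneous_part d"
  using homogeneous_part_add[of p d "- q"] by (simp add: homogeneous_part_uminus)

lemma homogeneous_part_zero [simp]: "0 \<in> homogeneous_part d"
  by (simp add: homogeneous_part_def)

lemma homogeneous_part_mult:
  assumes "p \<in> homogeneous_part c" "q \<in> homogeneous_part d"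
  shows "p * q \<in> homogeneous_part (c + d)"
  using assms keys_mult[of p q] by (fastforce simp: homogeneous_part_def)

lemma homogeneous_part_monom2: "int (fst e + snd e) = d \<Longrightarrow> monom2 e \<in> homogeneous_part d"
  by (simp add: homogeneous_part_def)

lemma homogeneous_part_shift:
  assumes "p \<in> homogeneous_part d"
  shows "shift e p \<in> homogeneous_part (d - int (fst e + snd e))"
  using assms by (force simp: homogeneous_part_def lookup_shift in_keys_iff algebra_simps)

lemma homogeneous_part_monom2_mult_iff:
  "monom2 e * p \<in> homogeneous_part d \<longleftrightarrow> p \<in> homogeneous_part (d - int (fst e + snd e))"
  by (auto simp: homogeneous_part_def keys_monom2_mult)

text \<open>This instance gives access to the definitions of the locale, \<open>regularity\<close>
  included. Applying \<open>hom_proj d\<close> to a decomposition returns its d-th component, whence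
  uniqueness.\<close>

lemma graded_module_mon_ideal:
  assumes "up_closed A"
  shows "graded_module (*) (mon_ideal A) (\<lambda>d. mon_ideal A \<inter> homogeneous_part d :: 'k::field poly2 set)"
proof -
  let ?M = "mon_ideal A :: 'k poly2 set"
  interpret m: module "(*) :: 'k poly2 \<Rightarrow> _" by (rule module_mult)
  note ideal = mon_ideal_is_ideal[OF assms, where 'k = 'k]
  show ?thesis
  proof
    show "is_ideal ?M" by (rule ideal)
    show "x - y \<in> ?M \<inter> homogeneous_part d"
      if "x \<in> ?M \<inter> homogeneous_part d" "y \<in> ?M \<inter> homogeneous_part d" for x y d
      using that by (simp add: homogeneous_part_diff is_ideal_diff[OF ideal])
    show "f * x \<in> ?M \<inter> homogeneous_part (c + d)"
      if "f \<in> homogeneous_part c" "x \<in> ?M \<inter> homogeneous_part d" for f x c d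
      using that ideal by (auto simp: homogeneous_part_mult is_ideal_def)
    fix x assume x: "x \<in> ?M"
    define D where "D = (\<lambda>e. int (fst e + snd e)) ` Poly_Mapping.keys x"
    define u where "u = (\<Sum>d\<in>D. Poly_Mapping.single d (hom_proj d x))"
    have finD: "finite D" by (simp add: D_def)
    have u: "Poly_Mapping.lookup u d = hom_proj d x" for d
    proof -
      have "Poly_Mapping.lookup u d = (\<Sum>i\<in>D. if i = d then hom_proj d x else 0)"
        unfolding u_def lookup_sum by (rule sum.cong) (auto simp: lookup_single when_def)
      also have "\<dots> = hom_proj d x"
      proof (cases "d \<in> D")
        case False
        then have "Poly_Mapping.keys (hom_proj d x) = {}" unfolding keys_hom_proj D_def by blast
        then show ?thesis using False by (simp add: finD)
      qed (simp add: finD)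
      finally show ?thesis .
    qed
    show "\<exists>!u :: int \<Rightarrow>\<^sub>0 'k poly2. (\<forall>d. Poly_Mapping.lookup u d \<in> ?M \<inter> homogeneous_part d) \<and>
        x = (\<Sum>d \<in> Poly_Mapping.keys u. Poly_Mapping.lookup u d)"
    proof (intro ex1I[of _ u] conjI allI)
      show "Poly_Mapping.lookup u d \<in> ?M \<inter> homogeneous_part d" for d
        using x by (auto simp: u mon_ideal_def keys_hom_proj)
      have "x = (\<Sum>d\<in>D. hom_proj d x)"
        by (rule hom_proj_sum_eq[symmetric]) (auto simp: D_def)
      also have "\<dots> = (\<Sum>d \<in> Poly_Mapping.keys u. Poly_Mapping.lookup u d)"
        unfolding u[symmetric]
      proof (rule sum.mono_neutral_right)
        show "Poly_Mapping.keys u \<subseteq> D"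
        proof
          fix d assume "d \<in> Poly_Mapping.keys u"
          then have "hom_proj d x \<noteq> 0" by (simp add: in_keys_iff u)
          then have "Poly_Mapping.keys (hom_proj d x) \<noteq> {}" by simp
          then show "d \<in> D" unfolding D_def keys_hom_proj by blast
        qed
      qed (auto simp: finD in_keys_iff)
      finally show "x = (\<Sum>d \<in> Poly_Mapping.keys u. Poly_Mapping.lookup u d)" .
    next
      fix v :: "int \<Rightarrow>\<^sub>0 'k poly2"
      assume v: "(\<forall>d. Poly_Mapping.lookup v d \<in> ?M \<inter> homogeneous_part d) \<and>
        x = (\<Sum>d \<in> Poly_Mapping.keys v. Poly_Mapping.lookup v d)"
      show "v = u"
      proof (rule poly_mapping_eqI)
        fix d
        have "hom_proj d x = (\<Sum>i\<in>Poly_Mapping.keys v. hom_proj d (Poly_Mapping.lookup v i))"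
          using v hom_proj_sum by metis
        also have "\<dots> = (\<Sum>i\<in>Poly_Mapping.keys v. if i = d then Poly_Mapping.lookup v d else 0)"
        proof (rule sum.cong[OF refl])
          fix i
          show "hom_proj d (Poly_Mapping.lookup v i) = (if i = d then Poly_Mapping.lookup v d else 0)"
            using v hom_proj_of_homogeneous[of "Poly_Mapping.lookup v i" i d] by (auto simp: when_def)
        qed
        also have "\<dots> = Poly_Mapping.lookup v d" by (simp add: in_keys_iff)
        finally show "Poly_Mapping.lookup v d = Poly_Mapping.lookup u d" by (simp add: u)
      qed
    qed
  qed (use ideal in \<open>auto simp: is_ideal_def\<close>)
qed

section \<open>Betti numbers of a monomial ideal from an arbitrary minimal resolution\<close>

abbreviation var_x :: "'k::field poly2" where "var_x \<equiv> monom2 (1, 0)"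
abbreviation var_y :: "'k::field poly2" where "var_y \<equiv> monom2 (0, 1)"

lemma lookup_vec_scale [simp]: "Poly_Mapping.lookup (vec_scale c v) k = c * Poly_Mapping.lookup v k"
  by (simp add: vec_scale_def Poly_Mapping.map.rep_eq when_def)

interpretation vec: module "vec_scale :: 'k::field poly2 \<Rightarrow> _"
  by standard (auto intro!: poly_mapping_eqI simp: lookup_add algebra_simps)

lemma lookup_map_zero: "f 0 = 0 \<Longrightarrow> Poly_Mapping.lookup (Poly_Mapping.map f v) k = f (Poly_Mapping.lookup v k)"
  by (simp add: Poly_Mapping.map.rep_eq when_def)

lemma free_module_iff: "v \<in> free_module as \<longleftrightarrow> (\<forall>k \<ge> length as. Poly_Mapping.lookup v k = 0)"
  unfolding free_module_def mem_Collect_eq subset_eq lessThan_iff by (metis in_keys_iff not_le)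

lemma free_module_closed [simp]:
  "0 \<in> free_module as"
  "v \<in> free_module as \<Longrightarrow> w \<in> free_module as \<Longrightarrow> v + w \<in> free_module as"
  "v \<in> free_module as \<Longrightarrow> w \<in> free_module as \<Longrightarrow> v - w \<in> free_module as"
  "v \<in> free_module as \<Longrightarrow> - v \<in> free_module as"
  "v \<in> free_module as \<Longrightarrow> vec_scale c v \<in> free_module as"
  by (auto simp: free_module_iff lookup_add lookup_minus)

lemma free_part_subset: "v \<in> free_part as d \<Longrightarrow> v \<in> free_module as"
  by (simp add: free_part_def)

lemma free_part_iff:
  "v \<in> free_part as d \<longleftrightarrow> v \<in> free_module as \<and>
    (\<forall>k < length as. Poly_Mapping.lookup v k \<in> homogeneous_part (d - as ! k))"
  by (simp add: free_part_def)

lemma free_part_add: "v \<in> free_part as d \<Longrightarrow> w \<in> free_part as d \<Longrightarrow> v + w \<in> free_part as d"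
  by (simp add: free_part_iff lookup_add homogeneous_part_add)

lemma free_part_vec_scale_monom2:
  assumes "v \<in> free_part as d" "int (fst e + snd e) = c"
  shows "vec_scale (monom2 e) v \<in> free_part as (c + d)"
  using assms by (auto simp: free_part_iff homogeneous_part_monom2_mult_iff)

lemma unit_vec_in_free_part:
  "k < length as \<Longrightarrow> Poly_Mapping.single k 1 \<in> free_part as (as ! k)"
  by (auto simp: free_part_iff free_module_iff lookup_single when_def homogeneous_part_def)

lemma vec_koszul:
  assumes "vec_scale var_x u + vec_scale var_y v = 0" "u \<in> free_module as"
  obtains w where "w \<in> free_module as" "u = vec_scale var_y w" "v = - vec_scale var_x w"
proof
  define w where "w = Poly_Mapping.map (shift (0, 1)) u"
  have *: "var_x * Poly_Mapping.lookup u k + var_y * Poly_Mapping.lookup v k = 0" for k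
    using assms(1) by (metis lookup_add lookup_vec_scale lookup_zero)
  show "w \<in> free_module as" using assms(2) by (auto simp: free_module_iff w_def lookup_map_zero)
  show "u = vec_scale var_y w" "v = - vec_scale var_x w"
    using monomial_koszul[OF *] by (auto intro!: poly_mapping_eqI simp: w_def lookup_map_zero)
qed

text \<open>All terms divisible by x go into the first summand; the rest contain no x and no
  constant, hence are divisible by y.\<close>

lemma irrelevant_split:
  fixes p :: "'k::field poly2"
  assumes "Poly_Mapping.lookup p 0 = 0"
  shows "p = var_x * shift (1, 0) p + var_y * shift (0, 1) (p - var_x * shift (1, 0) p)"
proof -
  have "Poly_Mapping.keys (p - var_x * shift (1, 0) p) \<subseteq> range ((+) (0, 1))"
  proof
    fix k assume k: "k \<in> Poly_Mapping.keys (p - var_x * shift (1, 0) p)"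
    have "k \<notin> range ((+) (1, 0))"
    proof
      assume "k \<in> range ((+) (1, 0))"
      then obtain t where t: "k = (1, 0) + t" by blast
      have "Poly_Mapping.lookup (p - var_x * shift (1, 0) p) k = 0"
        unfolding t lookup_minus lookup_monom2_mult_add lookup_shift by simp
      with k show False by (simp add: in_keys_iff)
    qed
    moreover have "k \<noteq> 0"
    proof
      assume "k = 0"
      moreover have "0 \<notin> Poly_Mapping.keys (var_x * shift (1, 0) p)"
        by (auto simp: keys_monom2_mult zero_prod_def)
      ultimately show False using k assms by (simp add: in_keys_iff lookup_minus)
    qed
    ultimately show "k \<in> range ((+) (0, 1))"
      unfolding range_plus_pair by (cases k) (auto simp: zero_prod_def)
  qed
  from monom2_mult_shift[OF this] show ?thesis by simp
qed

lemma homogeneous_irrelevant_parts: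
  fixes p :: "'k::field poly2"
  assumes "p \<in> homogeneous_part d"
  shows "shift (1, 0) p \<in> homogeneous_part (d - 1)"
    and "shift (0, 1) (p - var_x * shift (1, 0) p) \<in> homogeneous_part (d - 1)"
proof -
  show 1: "shift (1, 0) p \<in> homogeneous_part (d - 1)"
    using homogeneous_part_shift[OF assms, of "(1, 0)"] by simp
  then have "p - var_x * shift (1, 0) p \<in> homogeneous_part d"
    using assms by (intro homogeneous_part_diff) (auto simp: homogeneous_part_monom2_mult_iff)
  from homogeneous_part_shift[OF this, of "(0, 1)"]
  show "shift (0, 1) (p - var_x * shift (1, 0) p) \<in> homogeneous_part (d - 1)" by simp
qed

text \<open>The degree claims are implications, so that the splitting serves homogeneous vectors
  and, in \<open>betti2_empty\<close>, arbitrary ones.\<close>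

lemma vec_irrelevant_split:
  fixes v :: "nat \<Rightarrow>\<^sub>0 'k::field poly2"
  assumes "v \<in> free_module as" "\<And>k. Poly_Mapping.lookup v k \<in> irrelevant_ideal"
  obtains s t where "v = vec_scale var_x s + vec_scale var_y t"
    "s \<in> free_module as" "t \<in> free_module as"
    "\<And>d. v \<in> free_part as d \<Longrightarrow> s \<in> free_part as (d - 1)"
    "\<And>d. v \<in> free_part as d \<Longrightarrow> t \<in> free_part as (d - 1)"
proof
  define f :: "'k poly2 \<Rightarrow> 'k poly2" where "f = shift (1, 0)"
  define g :: "'k poly2 \<Rightarrow> 'k poly2" where "g = (\<lambda>p. shift (0, 1) (p - var_x * shift (1, 0) p))"
  define s where "s = Poly_Mapping.map f v"
  define t where "t = Poly_Mapping.map g v"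
  have s: "Poly_Mapping.lookup s k = f (Poly_Mapping.lookup v k)" for k
    by (simp add: s_def lookup_map_zero f_def)
  have t: "Poly_Mapping.lookup t k = g (Poly_Mapping.lookup v k)" for k
    by (simp add: t_def lookup_map_zero g_def)
  show "v = vec_scale var_x s + vec_scale var_y t"
  proof (rule poly_mapping_eqI)
    fix k
    show "Poly_Mapping.lookup v k = Poly_Mapping.lookup (vec_scale var_x s + vec_scale var_y t) k"
      unfolding lookup_add lookup_vec_scale s t f_def g_def
      by (rule irrelevant_split) (use assms(2) irrelevant_ideal_iff in blast)
  qed
  show mem: "s \<in> free_module as" "t \<in> free_module as"
    using assms(1) by (auto simp: free_module_iff s t f_def g_def)
  fix d assume "v \<in> free_part as d"
  then have *: "Poly_Mapping.lookup v k \<in> homogeneous_part (d - as ! k)" if "k < length as" for k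
    using that by (simp add: free_part_iff)
  have eq: "d - 1 - as ! k = d - as ! k - 1" for k by simp
  show "s \<in> free_part as (d - 1)" "t \<in> free_part as (d - 1)"
    unfolding free_part_iff s t f_def g_def eq
    using mem homogeneous_irrelevant_parts[OF *] by blast+
qed

text \<open>Coordinate \<open>k\<close> is cut at degree \<open>d - as ! k\<close> because the
  summand is S(-as ! k). Beyond the rank this degree is unspecified, but vectors of the free module
  vanish there.\<close>

definition vec_proj :: "int list \<Rightarrow> int \<Rightarrow> (nat \<Rightarrow>\<^sub>0 'k::field poly2) \<Rightarrow> (nat \<Rightarrow>\<^sub>0 'k poly2)" where
  "vec_proj as d v = Poly_Mapping.mapp (\<lambda>k. hom_proj (d - as ! k)) v"

lemma lookup_vec_proj: "Poly_Mapping.lookup (vec_proj as d v) k = hom_proj (d - as ! k) (Poly_Mapping.lookup v k)"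
  by (auto simp: vec_proj_def lookup_mapp when_def in_keys_iff)

lemma vec_proj_in_free_part: "v \<in> free_module as \<Longrightarrow> vec_proj as d v \<in> free_part as d"
  by (auto simp: free_part_iff free_module_iff lookup_vec_proj)

lemma vec_proj_add: "vec_proj as d (v + w) = vec_proj as d v + vec_proj as d w"
  by (rule poly_mapping_eqI, rule poly_mapping_eqI)
    (simp add: lookup_vec_proj lookup_add lookup_hom_proj when_add_distrib)

lemma vec_proj_of_free_part:
  assumes "v \<in> free_part as d"
  shows "vec_proj as d' v = (v when d' = d)"
proof (rule poly_mapping_eqI)
  fix k
  show "Poly_Mapping.lookup (vec_proj as d' v) k = Poly_Mapping.lookup (v when d' = d) k"
  proof (cases "k < length as")
    case True
    then have "Poly_Mapping.lookup v k \<in> homogeneous_part (d - as ! k)"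
      using assms by (simp add: free_part_iff)
    from hom_proj_of_homogeneous[OF this] show ?thesis
      by (auto simp: lookup_vec_proj when_def)
  next
    case False
    then show ?thesis using assms
      by (auto simp: free_part_iff free_module_iff lookup_vec_proj when_def)
  qed
qed

lemma vec_proj_sum:
  obtains D where "finite D" "d \<in> D" "(\<Sum>i\<in>D. vec_proj as i v) = v"
proof
  define D where "D = insert d (\<Union>k\<in>Poly_Mapping.keys v.
    (\<lambda>e. int (fst e + snd e) + as ! k) ` Poly_Mapping.keys (Poly_Mapping.lookup v k))"
  show fin: "finite D" and "d \<in> D" by (auto simp: D_def)
  show "(\<Sum>i\<in>D. vec_proj as i v) = v"
  proof (rule poly_mapping_eqI)
    fix k
    have "Poly_Mapping.lookup (\<Sum>i\<in>D. vec_proj as i v) k =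
      (\<Sum>i\<in>D. hom_proj (i - as ! k) (Poly_Mapping.lookup v k))"
      by (simp add: lookup_sum lookup_vec_proj)
    also have "\<dots> = (\<Sum>i\<in>(\<lambda>i. i - as ! k) ` D. hom_proj i (Poly_Mapping.lookup v k))"
      by (subst sum.reindex) (auto simp: inj_on_def)
    also have "\<dots> = Poly_Mapping.lookup v k"
    proof (rule hom_proj_sum_eq)
      fix e assume e: "e \<in> Poly_Mapping.keys (Poly_Mapping.lookup v k)"
      then have "k \<in> Poly_Mapping.keys v" by (auto simp: in_keys_iff)
      with e have "int (fst e + snd e) + as ! k \<in> D" unfolding D_def by blast
      then show "int (fst e + snd e) \<in> (\<lambda>i. i - as ! k) ` D" by force
    qed (use fin in auto)
    finally show "Poly_Mapping.lookup (\<Sum>i\<in>D. vec_proj as i v) k = Poly_Mapping.lookup v k" .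
  qed
qed

text \<open>Applying the projection of degree \<open>d\<close> to the image of the decomposition of
  \<open>v\<close> leaves only the image of the d-th component. Preimages of homogeneous elements
  can hence be chosen homogeneous; \<open>T\<close> and \<open>\<pi>\<close> are abstract so as to
  cover both the augmentation and the differentials.\<close>

lemma graded_hom_commutes_proj:
  fixes f :: "(nat \<Rightarrow>\<^sub>0 'k::field poly2) \<Rightarrow> 'm::ab_group_add"
  assumes f: "\<And>v w. f (v + w) = f v + f w"
    and graded: "\<And>d. f ` free_part as d \<subseteq> T d"
    and \<pi>: "\<And>d x y. \<pi> d (x + y) = \<pi> d x + \<pi> d y"
      "\<And>d d' x. x \<in> T d' \<Longrightarrow> \<pi> d x = (x when d = d')"
    and v: "v \<in> free_module as" "f v \<in> T d"
  shows "f (vec_proj as d v) = f v"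
proof -
  interpret f: additive f by standard (rule f)
  interpret \<pi>: additive "\<pi> d" by standard (rule \<pi>)
  obtain D where D: "finite D" "d \<in> D" "(\<Sum>i\<in>D. vec_proj as i v) = v"
    by (rule vec_proj_sum)
  have "f v = \<pi> d (f v)" using \<pi>(2)[OF v(2)] by simp
  also have "\<dots> = \<pi> d (\<Sum>i\<in>D. f (vec_proj as i v))" using D(3) f.sum by metis
  also have "\<dots> = (\<Sum>i\<in>D. \<pi> d (f (vec_proj as i v)))" by (rule \<pi>.sum)
  also have "\<dots> = (\<Sum>i\<in>D. if i = d then f (vec_proj as d v) else 0)"
  proof (rule sum.cong[OF refl])
    fix i
    have "f (vec_proj as i v) \<in> T i" using graded vec_proj_in_free_part[OF v(1)] by blast
    from \<pi>(2)[OF this] show "\<pi> d (f (vec_proj as i v)) = (if i = d then f (vec_proj as d v) else 0)"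
      by (auto simp: when_def)
  qed
  also have "\<dots> = f (vec_proj as d v)" using D by simp
  finally show ?thesis ..
qed

text \<open>For up-closed \<open>A\<close>, comparing with the two immediate predecessors suffices
  for minimality under divisibility.\<close>

definition min_gens :: "(nat \<times> nat) set \<Rightarrow> (nat \<times> nat) set" where
  "min_gens A = {e \<in> A. \<forall>a\<in>A. (1, 0) + a \<noteq> e \<and> (0, 1) + a \<noteq> e}"

definition corners :: "(nat \<times> nat) set \<Rightarrow> (nat \<times> nat) set" where
  "corners A = {w. w \<notin> A \<and> (1, 0) + w \<in> A \<and> (0, 1) + w \<in> A}"

abbreviation total_degree :: "nat \<times> nat \<Rightarrow> int" where
  "total_degree e \<equiv> int (fst e + snd e)"

lemma is_ideal_irrelevant_mult:
  fixes J :: "'k::field poly2 set"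
  assumes "is_ideal J"
  shows "is_ideal {var_x * u + var_y * v | u v. u \<in> J \<and> v \<in> J}" (is "is_ideal ?K")
  unfolding is_ideal_def
proof (intro conjI ballI allI)
  show "0 \<in> ?K" using assms by (auto simp: is_ideal_def intro!: exI[of _ 0])
  fix p assume "p \<in> ?K"
  then obtain u v where p: "p = var_x * u + var_y * v" "u \<in> J" "v \<in> J" by blast
  have "c * p = var_x * (c * u) + var_y * (c * v)" for c by (simp add: p algebra_simps)
  moreover have "c * u \<in> J" "c * v \<in> J" for c using p assms by (auto simp: is_ideal_def)
  ultimately show "c * p \<in> ?K" for c by blast
  fix q assume "q \<in> ?K"
  then obtain u' v' where q: "q = var_x * u' + var_y * v'" "u' \<in> J" "v' \<in> J" by blast
  have "p + q = var_x * (u + u') + var_y * (v + v')" by (simp add: p q algebra_simps)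
  moreover have "u + u' \<in> J" "v + v' \<in> J" using p q assms by (auto simp: is_ideal_def)
  ultimately show "p + q \<in> ?K" by blast
qed

text \<open>Every term of \<open>p\<close> has degree \<open>j\<close>, so its exponent is no
  minimal generator and arises from another exponent of \<open>A\<close> by one step.\<close>

lemma homogeneous_without_min_gens:
  fixes p :: "'k::field poly2"
  assumes A: "up_closed A" and p: "p \<in> mon_ideal A" "p \<in> homogeneous_part j"
    and no_gen: "\<And>e. e \<in> min_gens A \<Longrightarrow> total_degree e \<noteq> j"
  obtains u v where "u \<in> mon_ideal A" "v \<in> mon_ideal A" "p = var_x * u + var_y * v"
proof -
  let ?J = "mon_ideal A :: 'k poly2 set"
  let ?K = "{var_x * u + var_y * v | u v. u \<in> ?J \<and> v \<in> ?J}"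
  note J = mon_ideal_is_ideal[OF A, where 'k = 'k]
  note K = is_ideal_irrelevant_mult[OF J]
  have "(\<Sum>k\<in>Poly_Mapping.keys p. Poly_Mapping.single k (Poly_Mapping.lookup p k)) \<in> ?K"
  proof (rule is_ideal_sum[OF K])
    fix k assume k: "k \<in> Poly_Mapping.keys p"
    then have "k \<in> A" "total_degree k = j" using p by (auto simp: mon_ideal_def homogeneous_part_def)
    then obtain a where a: "a \<in> A" "(1, 0) + a = k \<or> (0, 1) + a = k"
      using no_gen unfolding min_gens_def by blast
    then have "monom2 k = var_x * monom2 a + var_y * 0 \<or> monom2 k = var_x * 0 + var_y * (monom2 a :: 'k poly2)"
      by (auto simp: monom2_mult)
    moreover have "monom2 a \<in> ?J" "0 \<in> ?J" using a J by (auto simp: is_ideal_def)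
    ultimately have "monom2 k \<in> ?K" by blast
    then have "Poly_Mapping.single 0 (Poly_Mapping.lookup p k) * monom2 k \<in> ?K"
      using K unfolding is_ideal_def by blast
    then show "Poly_Mapping.single k (Poly_Mapping.lookup p k) \<in> ?K"
      by (simp add: monom2_def mult_single)
  qed
  then show ?thesis using that poly_mapping_sum_single[of p] by auto
qed

locale mon_ideal_resolution =
  fixes A :: "(nat \<times> nat) set" and as :: "nat \<Rightarrow> int list"
    and \<epsilon> :: "(nat \<Rightarrow>\<^sub>0 'k::field poly2) \<Rightarrow> 'k poly2"
    and \<phi> :: "nat \<Rightarrow> (nat \<Rightarrow>\<^sub>0 'k poly2) \<Rightarrow> (nat \<Rightarrow>\<^sub>0 'k poly2)"
  assumes A: "up_closed A"
    and resolution: "graded_module.minimal_graded_free_resolution (*) (mon_ideal A)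
      (\<lambda>d. mon_ideal A \<inter> homogeneous_part d) as \<epsilon> \<phi>"
begin

lemmas resolution_unfolded = resolution[unfolded
    graded_module.minimal_graded_free_resolution_def[OF graded_module_mon_ideal[OF A]]]

lemma eps_hom: "module_hom vec_scale (*) \<epsilon>"
  using resolution_unfolded by (elim conjE)

lemma phi_hom: "module_hom vec_scale vec_scale (\<phi> i)"
  using resolution_unfolded by (elim conjE allE)

lemma eps_part: "v \<in> free_part (as 0) d \<Longrightarrow> \<epsilon> v \<in> homogeneous_part d"
proof -
  have "\<forall>d. \<epsilon> ` free_part (as 0) d \<subseteq> mon_ideal A \<inter> homogeneous_part d"
    using resolution_unfolded by (elim conjE)
  then show "v \<in> free_part (as 0) d \<Longrightarrow> \<epsilon> v \<in> homogeneous_part d" by blast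
qed

lemma phi_part: "v \<in> free_part (as (Suc i)) d \<Longrightarrow> \<phi> i v \<in> free_part (as i) d"
proof -
  have "\<forall>i d. \<phi> i ` free_part (as (Suc i)) d \<subseteq> free_part (as i) d"
    using resolution_unfolded by (elim conjE)
  then show "v \<in> free_part (as (Suc i)) d \<Longrightarrow> \<phi> i v \<in> free_part (as i) d" by blast
qed

lemma eps_image: "\<epsilon> ` free_module (as 0) = mon_ideal A"
  using resolution_unfolded by (elim conjE)

lemma kernel_eps: "{v \<in> free_module (as 0). \<epsilon> v = 0} = \<phi> 0 ` free_module (as 1)"
  using resolution_unfolded by (elim conjE)

lemma kernel_phi:
  "{v \<in> free_module (as (Suc i)). \<phi> i v = 0} = \<phi> (Suc i) ` free_module (as (Suc (Suc i)))"
  using resolution_unfolded by (elim conjE) (erule allE)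

lemma minimal:
  assumes "v \<in> free_module (as (Suc i))"
  shows "Poly_Mapping.lookup (\<phi> i v) k \<in> irrelevant_ideal"
proof -
  have "\<forall>i. \<forall>v \<in> free_module (as (Suc i)). \<forall>k. Poly_Mapping.lookup (\<phi> i v) k \<in> irrelevant_ideal"
    using resolution_unfolded by (elim conjE)
  with assms show ?thesis by blast
qed

lemmas eps_add = module_hom.add[OF eps_hom]
lemmas eps_diff = module_hom.diff[OF eps_hom]
lemmas eps_scale = module_hom.scale[OF eps_hom]
lemmas phi_add = module_hom.add[OF phi_hom]
lemmas phi_diff = module_hom.diff[OF phi_hom]
lemmas phi_scale = module_hom.scale[OF phi_hom]

lemma eps_surj:
  assumes "p \<in> mon_ideal A"
  obtains v where "v \<in> free_module (as 0)" "\<epsilon> v = p"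
  using assms that unfolding eps_image[symmetric] by (elim imageE) simp

lemma eps_in: "v \<in> free_module (as 0) \<Longrightarrow> \<epsilon> v \<in> mon_ideal A"
  unfolding eps_image[symmetric] by (rule imageI)

lemma eps_exact:
  assumes "v \<in> free_module (as 0)" "\<epsilon> v = 0"
  obtains s where "s \<in> free_module (as (Suc 0))" "\<phi> 0 s = v"
proof -
  have "v \<in> \<phi> 0 ` free_module (as 1)" unfolding kernel_eps[symmetric] using assms by simp
  then show ?thesis using that by (elim imageE) simp
qed

lemma phi_exact:
  assumes "v \<in> free_module (as (Suc i))" "\<phi> i v = 0"
  obtains s where "s \<in> free_module (as (Suc (Suc i)))" "\<phi> (Suc i) s = v"
proof -
  have "v \<in> \<phi> (Suc i) ` free_module (as (Suc (Suc i)))" unfolding kernel_phi[symmetric] using assms by simp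
  then show ?thesis using that by (elim imageE) simp
qed

lemma
  assumes "s \<in> free_module (as (Suc 0))"
  shows phi_in_0: "\<phi> 0 s \<in> free_module (as 0)" and eps_phi: "\<epsilon> (\<phi> 0 s) = 0"
proof -
  have "\<phi> 0 s \<in> {v \<in> free_module (as 0). \<epsilon> v = 0}"
    unfolding kernel_eps using assms by simp
  then show "\<phi> 0 s \<in> free_module (as 0)" "\<epsilon> (\<phi> 0 s) = 0" by simp_all
qed

lemma
  assumes "s \<in> free_module (as (Suc (Suc i)))"
  shows phi_in_Suc: "\<phi> (Suc i) s \<in> free_module (as (Suc i))" and phi_phi: "\<phi> i (\<phi> (Suc i) s) = 0"
proof -
  have "\<phi> (Suc i) s \<in> {v \<in> free_module (as (Suc i)). \<phi> i v = 0}"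
    unfolding kernel_phi using assms by simp
  then show "\<phi> (Suc i) s \<in> free_module (as (Suc i))" "\<phi> i (\<phi> (Suc i) s) = 0" by simp_all
qed

lemma phi_in: "v \<in> free_module (as (Suc i)) \<Longrightarrow> \<phi> i v \<in> free_module (as i)"
  using phi_in_0 phi_in_Suc by (cases i) auto

text \<open>The constant term of coordinate \<open>k\<close> on the left is 1, while minimality
  forbids constants in images. The chases excluding a basis vector end here: modulo (x, y) it would
  be a boundary.\<close>

lemma unit_vec_not_irrelevant:
  assumes "v \<in> free_module (as (Suc i))"
  shows "Poly_Mapping.single k 1 - vec_scale var_x s - vec_scale var_y t \<noteq> \<phi> i v"
proof
  assume "Poly_Mapping.single k 1 - vec_scale var_x s - vec_scale var_y t = \<phi> i v"
  then have "Poly_Mapping.lookup (Poly_Mapping.single k 1 - vec_scale var_x s - vec_scale var_y t) k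
     \<in> irrelevant_ideal"
    using minimal[OF assms] by simp
  then have "Poly_Mapping.lookup (1 - var_x * Poly_Mapping.lookup s k - var_y * Poly_Mapping.lookup t k) 0 = 0"
    by (simp add: irrelevant_ideal_iff lookup_minus)
  moreover have "0 \<notin> Poly_Mapping.keys (var_x * Poly_Mapping.lookup s k)"
    "0 \<notin> Poly_Mapping.keys (var_y * Poly_Mapping.lookup t k)"
    by (auto simp: keys_monom2_mult zero_prod_def)
  ultimately show False by (simp add: lookup_minus in_keys_iff)
qed

lemma eps_lift_part:
  assumes "p \<in> mon_ideal A" "p \<in> homogeneous_part d"
  obtains v where "v \<in> free_part (as 0) d" "\<epsilon> v = p"
proof -
  obtain v where v: "v \<in> free_module (as 0)" "\<epsilon> v = p" using assms(1) by (rule eps_surj)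
  have "\<epsilon> (vec_proj (as 0) d v) = \<epsilon> v"
  proof (rule graded_hom_commutes_proj[where f = \<epsilon> and T = homogeneous_part and \<pi> = hom_proj])
    show "\<epsilon> ` free_part (as 0) d \<subseteq> homogeneous_part d" for d
      using eps_part by (rule image_subsetI)
    show "\<epsilon> v \<in> homogeneous_part d" using v(2) assms(2) by simp
  qed (rule eps_add hom_proj_add hom_proj_of_homogeneous v, assumption?)+
  with v have "\<epsilon> (vec_proj (as 0) d v) = p" by simp
  with vec_proj_in_free_part[OF v(1)] show ?thesis by (rule that)
qed

lemma phi_lift_part:
  assumes z: "\<phi> i v \<in> free_part (as i) d" "v \<in> free_module (as (Suc i))"
  obtains w where "w \<in> free_part (as (Suc i)) d" "\<phi> i w = \<phi> i v"
proof -
  have "\<phi> i (vec_proj (as (Suc i)) d v) = \<phi> i v"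
  proof (rule graded_hom_commutes_proj[where f = "\<phi> i" and T = "free_part (as i)" and \<pi> = "vec_proj (as i)"])
    show "\<phi> i ` free_part (as (Suc i)) d \<subseteq> free_part (as i) d" for d
      using phi_part by (rule image_subsetI)
  qed (rule phi_add vec_proj_add vec_proj_of_free_part z, assumption?)+
  with vec_proj_in_free_part[OF z(2)] show ?thesis by (rule that)
qed

text \<open>Coordinate \<open>k\<close> is homogeneous of degree \<open>d - bs ! k\<close>, which is
  nonzero, so it has no constant term. In this form the absence of a shift \<open>d\<close> enters
  the converse chases.\<close>

lemma free_part_irrelevant:
  assumes "v \<in> free_part bs d" "d \<notin> set bs"
  shows "Poly_Mapping.lookup v k \<in> irrelevant_ideal"
proof (cases "k < length bs")
  case True
  then have "Poly_Mapping.lookup v k \<in> homogeneous_part (d - bs ! k)" "d \<noteq> bs ! k"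
    using assms by (auto simp: free_part_iff)
  then have "0 \<notin> Poly_Mapping.keys (Poly_Mapping.lookup v k)" by (auto simp: homogeneous_part_def)
  then show ?thesis by (simp add: irrelevant_ideal_iff in_keys_iff)
next
  case False
  then show ?thesis using assms by (auto simp: free_part_iff free_module_iff irrelevant_ideal_iff)
qed

lemma unit_in_free_module: "k < length (as i) \<Longrightarrow> Poly_Mapping.single k 1 \<in> free_module (as i)"
  by (rule free_part_subset, rule unit_vec_in_free_part)

text \<open>Without a generator in degree \<open>j\<close> the image of the basis vector lies in (x,
  y) I. Lifting the two coefficients along \<epsilon> changes the basis vector, modulo (x, y), into
  a cycle, which exactness makes a boundary.\<close>

lemma betti0_imp_min_gen:
  assumes "j \<in> set (as 0)"
  shows "\<exists>e\<in>min_gens A. total_degree e = j"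
proof (rule ccontr)
  assume neg: "\<not> ?thesis"
  from assms obtain k where k: "k < length (as 0)" "as 0 ! k = j" by (auto simp: in_set_conv_nth)
  define b :: "nat \<Rightarrow>\<^sub>0 'k poly2" where "b = Poly_Mapping.single k 1"
  have b: "b \<in> free_part (as 0) j" using unit_vec_in_free_part k by (auto simp: b_def)
  then have "\<epsilon> b \<in> mon_ideal A" by (intro eps_in free_part_subset)
  moreover have "\<epsilon> b \<in> homogeneous_part j" using b by (rule eps_part)
  ultimately obtain u v where uv: "u \<in> mon_ideal A" "v \<in> mon_ideal A" "\<epsilon> b = var_x * u + var_y * v"
    by (rule homogeneous_without_min_gens[OF A]) (use neg in blast)
  obtain s where s: "s \<in> free_module (as 0)" "\<epsilon> s = u" using uv(1) by (rule eps_surj)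
  obtain t where t: "t \<in> free_module (as 0)" "\<epsilon> t = v" using uv(2) by (rule eps_surj)
  note st = s t
  have "\<epsilon> (b - vec_scale var_x s - vec_scale var_y t) = 0"
    using st uv by (simp add: eps_diff eps_scale)
  moreover have "b - vec_scale var_x s - vec_scale var_y t \<in> free_module (as 0)"
    using st free_part_subset[OF b] by simp
  ultimately obtain r where "r \<in> free_module (as (Suc 0))" "\<phi> 0 r = b - vec_scale var_x s - vec_scale var_y t"
    using eps_exact by blast
  then show False using unit_vec_not_irrelevant[of r 0 k s t] unfolding b_def by simp
qed

text \<open>If the degree is missing, a homogeneous lift of the monomial has coordinates without
  constant terms, which places a minimal generator in (x, y) I.\<close>

lemma min_gen_imp_betti0:
  assumes e: "e \<in> min_gens A"
  shows "total_degree e \<in> set (as 0)"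
proof (rule ccontr)
  assume neg: "total_degree e \<notin> set (as 0)"
  from e have "monom2 e \<in> (mon_ideal A :: 'k poly2 set)" by (simp add: min_gens_def)
  then obtain v where v: "v \<in> free_part (as 0) (total_degree e)" "\<epsilon> v = monom2 e"
    by (rule eps_lift_part[OF _ homogeneous_part_monom2[OF refl]])
  obtain s t where st: "v = vec_scale var_x s + vec_scale var_y t" "s \<in> free_module (as 0)" "t \<in> free_module (as 0)"
    by (rule vec_irrelevant_split[OF free_part_subset[OF v(1)] free_part_irrelevant[OF v(1) neg]])
  have "monom2 e = var_x * \<epsilon> s + var_y * \<epsilon> t" using v st by (simp add: eps_add eps_scale)
  then have "e \<in> Poly_Mapping.keys (var_x * \<epsilon> s + var_y * \<epsilon> t)"
    by (metis keys_monom2 singletonI)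
  then have "e \<in> (+) (1, 0) ` Poly_Mapping.keys (\<epsilon> s) \<union> (+) (0, 1) ` Poly_Mapping.keys (\<epsilon> t)"
    using keys_add[of "var_x * \<epsilon> s" "var_y * \<epsilon> t"] by (auto simp: keys_monom2_mult)
  moreover have "Poly_Mapping.keys (\<epsilon> s) \<subseteq> A" "Poly_Mapping.keys (\<epsilon> t) \<subseteq> A"
    using eps_in[OF st(2)] eps_in[OF st(3)] by (simp_all add: mon_ideal_def)
  ultimately show False using e unfolding min_gens_def by blast
qed

text \<open>Splitting the image of the basis vector as x u + y v and applying \<epsilon> yields a
  Koszul relation, solved by a polynomial \<open>w\<close>. If \<open>w\<close> were in the ideal,
  lifting it would correct \<open>u\<close> and \<open>v\<close> to cycles and make the basis vector
  a boundary modulo (x, y). So some exponent of \<open>w\<close> is outside \<open>A\<close>; it is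
  a corner because y w and x w lie in the ideal.\<close>

lemma betti1_imp_corner:
  assumes "j \<in> set (as 1)"
  shows "\<exists>w\<in>corners A. total_degree w + 2 = j"
proof -
  from assms obtain k where k: "k < length (as 1)" "as 1 ! k = j" by (auto simp: in_set_conv_nth)
  define b :: "nat \<Rightarrow>\<^sub>0 'k poly2" where "b = Poly_Mapping.single k 1"
  have b: "b \<in> free_part (as 1) j" using unit_vec_in_free_part k by (auto simp: b_def)
  then have b': "b \<in> free_module (as 1)" by (rule free_part_subset)
  have \<phi>b: "\<phi> 0 b \<in> free_part (as 0) j" using phi_part b by simp
  obtain u v where uv: "\<phi> 0 b = vec_scale var_x u + vec_scale var_y v"
    "u \<in> free_part (as 0) (j - 1)" "v \<in> free_part (as 0) (j - 1)"
    by (rule vec_irrelevant_split[OF free_part_subset[OF \<phi>b] minimal[of b 0]]) (use b' \<phi>b in auto)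
  note uv' = free_part_subset[OF uv(2)] free_part_subset[OF uv(3)]
  have "\<epsilon> (\<phi> 0 b) = 0" using b' by (intro eps_phi) simp
  then have eq: "var_x * \<epsilon> u + var_y * \<epsilon> v = 0" by (simp add: uv eps_add eps_scale)
  define w where "w = shift (0, 1) (\<epsilon> u)"
  have w: "\<epsilon> u = var_y * w" "\<epsilon> v = - var_x * w"
    using monomial_koszul[OF eq] by (auto simp: w_def)
  have "w \<notin> mon_ideal A"
  proof
    assume "w \<in> mon_ideal A"
    then obtain z where z: "z \<in> free_module (as 0)" "\<epsilon> z = w" by (rule eps_surj)
    have "\<epsilon> (u - vec_scale var_y z) = 0" "\<epsilon> (v + vec_scale var_x z) = 0"
      using w z by (simp_all add: eps_add eps_diff eps_scale)
    moreover have "u - vec_scale var_y z \<in> free_module (as 0)" "v + vec_scale var_x z \<in> free_module (as 0)"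
      using uv' z by simp_all
    ultimately obtain s t where st: "s \<in> free_module (as (Suc 0))" "\<phi> 0 s = u - vec_scale var_y z"
      "t \<in> free_module (as (Suc 0))" "\<phi> 0 t = v + vec_scale var_x z"
      by (metis eps_exact)
    have "\<phi> 0 (b - vec_scale var_x s - vec_scale var_y t) = 0"
      by (simp add: phi_diff phi_scale st uv vec.scale_right_diff_distrib vec.scale_right_distrib mult.commute)
    moreover have "b - vec_scale var_x s - vec_scale var_y t \<in> free_module (as (Suc 0))"
      using st b' by simp
    ultimately obtain r where "r \<in> free_module (as (Suc (Suc 0)))"
      "\<phi> (Suc 0) r = b - vec_scale var_x s - vec_scale var_y t"
      by (metis phi_exact)
    then show False using unit_vec_not_irrelevant[of r "Suc 0" k s t] unfolding b_def by simp
  qed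
  then obtain e where e: "e \<in> Poly_Mapping.keys w" "e \<notin> A" by (auto simp: mon_ideal_def)
  have "(0, 1) + e \<in> Poly_Mapping.keys (\<epsilon> u)" using e by (simp add: w keys_monom2_mult)
  moreover have "(1, 0) + e \<in> Poly_Mapping.keys (\<epsilon> v)"
    using e keys_monom2_mult[of "(1, 0)" w] by (simp add: w in_keys_iff)
  moreover have "Poly_Mapping.keys (\<epsilon> u) \<subseteq> A" "Poly_Mapping.keys (\<epsilon> v) \<subseteq> A"
    using eps_in[OF uv'(1)] eps_in[OF uv'(2)] by (simp_all add: mon_ideal_def)
  ultimately have "e \<in> corners A" using e by (auto simp: corners_def)
  \<comment> \<open>\<open>u\<close> has degree j - 1 and maps to y w, so the exponents of
    \<open>w\<close> have degree j - 2.\<close>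
  moreover have "total_degree ((0, 1) + e) = j - 1"
    using eps_part[OF uv(2)] \<open>(0, 1) + e \<in> Poly_Mapping.keys (\<epsilon> u)\<close> unfolding homogeneous_part_def by blast
  then have "total_degree e + 2 = j" by simp
  ultimately show ?thesis by blast
qed

text \<open>The same construction backwards: y w and -x w are lifted to \<open>u\<close> and
  \<open>v\<close>, and x u + y v is a syzygy of degree deg w + 2. If it came from (x, y) times the
  first syzygy module of the resolution, correcting \<open>u\<close> and \<open>v\<close> by
  boundaries would give a Koszul relation between vectors, whose solution maps to the monomial of
  \<open>w\<close>; but that monomial is not in the ideal.\<close>

lemma corner_imp_betti1:
  assumes w: "w \<in> corners A"
  shows "total_degree w + 2 \<in> set (as 1)"
proof (rule ccontr)
  define j where "j = total_degree w + 2"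
  assume "\<not> ?thesis"
  then have neg: "j \<notin> set (as 1)" by (simp add: j_def)
  from w have mem: "monom2 ((0, 1) + w) \<in> (mon_ideal A :: 'k poly2 set)"
    "- monom2 ((1, 0) + w) \<in> (mon_ideal A :: 'k poly2 set)"
    by (auto simp: corners_def mon_ideal_def in_keys_iff)
  have hom: "monom2 ((0, 1) + w) \<in> (homogeneous_part (j - 1) :: 'k poly2 set)"
    "- monom2 ((1, 0) + w) \<in> (homogeneous_part (j - 1) :: 'k poly2 set)"
    by (auto intro!: homogeneous_part_monom2 homogeneous_part_uminus simp: j_def)
  obtain u where u: "u \<in> free_part (as 0) (j - 1)" "\<epsilon> u = monom2 ((0, 1) + w)"
    by (rule eps_lift_part[OF mem(1) hom(1)])
  obtain v where v: "v \<in> free_part (as 0) (j - 1)" "\<epsilon> v = - monom2 ((1, 0) + w)"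
    by (rule eps_lift_part[OF mem(2) hom(2)])
  define z where "z = vec_scale var_x u + vec_scale var_y v"
  have z: "z \<in> free_part (as 0) j"
    using free_part_vec_scale_monom2[OF u(1), of "(1, 0)" 1] free_part_vec_scale_monom2[OF v(1), of "(0, 1)" 1]
    by (auto simp: z_def intro: free_part_add)
  have "\<epsilon> z = 0" using u v by (simp add: z_def eps_add eps_scale monom2_mult add.left_commute)
  with free_part_subset[OF z] obtain r' where r': "r' \<in> free_module (as (Suc 0))" "\<phi> 0 r' = z"
    by (rule eps_exact)
  with z phi_lift_part[of 0 r' j] obtain r where r: "r \<in> free_part (as 1) j" "\<phi> 0 r = z"
    by (metis One_nat_def)
  obtain s t where st: "r = vec_scale var_x s + vec_scale var_y t"
    "s \<in> free_module (as 1)" "t \<in> free_module (as 1)"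
    by (rule vec_irrelevant_split[OF free_part_subset[OF r(1)] free_part_irrelevant[OF r(1) neg]])
  have \<phi>s: "\<phi> 0 s \<in> free_module (as 0)" "\<epsilon> (\<phi> 0 s) = 0"
    using st by (simp_all add: phi_in_0 eps_phi)
  have "vec_scale var_x (u - \<phi> 0 s) + vec_scale var_y (v - \<phi> 0 t) = 0"
    using r(2) by (simp add: st phi_add phi_scale z_def vec.scale_right_diff_distrib algebra_simps)
  moreover have "u - \<phi> 0 s \<in> free_module (as 0)" using free_part_subset[OF u(1)] \<phi>s by simp
  ultimately obtain y where y: "y \<in> free_module (as 0)" "u - \<phi> 0 s = vec_scale var_y y"
    by (rule vec_koszul)
  have "var_y * \<epsilon> y = \<epsilon> (u - \<phi> 0 s)" using y by (simp add: eps_scale)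
  also have "\<dots> = var_y * monom2 w" using u \<phi>s by (simp add: eps_diff monom2_mult)
  finally have "\<epsilon> y = monom2 w" by simp
  then have "monom2 w \<in> (mon_ideal A :: 'k poly2 set)" using eps_in[OF y(1)] by simp
  then show False using w by (simp add: corners_def)
qed

text \<open>With two variables the Koszul chase closes up: the vector \<open>w\<close> found two
  steps below satisfies y \<epsilon>(w) = 0, hence is a cycle, and no obstruction to making the
  basis vector a boundary modulo (x, y) remains.\<close>

lemma betti2_empty: "as (Suc (Suc 0)) = []"
proof (rule ccontr)
  assume "as (Suc (Suc 0)) \<noteq> []"
  define b :: "nat \<Rightarrow>\<^sub>0 'k poly2" where "b = Poly_Mapping.single 0 1"
  have b: "b \<in> free_module (as (Suc (Suc 0)))"
    unfolding b_def using \<open>as (Suc (Suc 0)) \<noteq> []\<close> by (intro unit_in_free_module) auto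
  obtain u v where uv: "\<phi> (Suc 0) b = vec_scale var_x u + vec_scale var_y v"
    "u \<in> free_module (as (Suc 0))" "v \<in> free_module (as (Suc 0))"
    using vec_irrelevant_split[OF phi_in[OF b] minimal[OF b]] by metis
  have "\<phi> 0 (\<phi> (Suc 0) b) = 0" using phi_phi[OF b] by simp
  then have "vec_scale var_x (\<phi> 0 u) + vec_scale var_y (\<phi> 0 v) = 0" using uv(1) by (simp add: phi_add phi_scale)
  moreover have "\<phi> 0 u \<in> free_module (as 0)" using phi_in uv by simp
  ultimately obtain w where w: "w \<in> free_module (as 0)" "\<phi> 0 u = vec_scale var_y w" "\<phi> 0 v = - vec_scale var_x w"
    by (rule vec_koszul)
  have "\<epsilon> (\<phi> 0 u) = 0" using uv by (simp add: eps_phi)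
  then have "\<epsilon> w = 0" by (simp add: w eps_scale)
  with w(1) obtain z where z: "z \<in> free_module (as (Suc 0))" "\<phi> 0 z = w" by (rule eps_exact)
  have "\<phi> 0 (u - vec_scale var_y z) = 0" "\<phi> 0 (v + vec_scale var_x z) = 0"
    using w z by (simp_all add: phi_add phi_diff phi_scale)
  moreover have "u - vec_scale var_y z \<in> free_module (as (Suc 0))" "v + vec_scale var_x z \<in> free_module (as (Suc 0))"
    using uv z by simp_all
  ultimately obtain s t where st: "s \<in> free_module (as (Suc (Suc 0)))" "\<phi> (Suc 0) s = u - vec_scale var_y z"
    "t \<in> free_module (as (Suc (Suc 0)))" "\<phi> (Suc 0) t = v + vec_scale var_x z"
    by (metis phi_exact)
  have "\<phi> (Suc 0) (b - vec_scale var_x s - vec_scale var_y t) = 0"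
    using uv(1) by (simp add: phi_diff phi_scale st vec.scale_right_diff_distrib vec.scale_right_distrib mult.commute)
  moreover have "b - vec_scale var_x s - vec_scale var_y t \<in> free_module (as (Suc (Suc 0)))"
    using st b by simp
  ultimately obtain r where "r \<in> free_module (as (Suc (Suc (Suc 0))))"
    "\<phi> (Suc (Suc 0)) r = b - vec_scale var_x s - vec_scale var_y t"
    by (metis phi_exact)
  then show False using unit_vec_not_irrelevant[of r "Suc (Suc 0)" 0 s t] unfolding b_def by simp
qed

text \<open>Once a module in the resolution vanishes, a basis vector of the next one would be a
  cycle, hence a boundary, against minimality.\<close>

lemma betti_empty: "as (Suc (Suc i)) = []"
proof (induction i)
  case 0
  show ?case by (rule betti2_empty)
next
  case (Suc i)
  show ?case
  proof (rule ccontr)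
    assume *: "as (Suc (Suc (Suc i))) \<noteq> []"
    define b :: "nat \<Rightarrow>\<^sub>0 'k poly2" where "b = Poly_Mapping.single 0 1"
    have b: "b \<in> free_module (as (Suc (Suc (Suc i))))"
      unfolding b_def using * by (intro unit_in_free_module) auto
    have "\<phi> (Suc (Suc i)) b \<in> free_module (as (Suc (Suc i)))" by (rule phi_in[OF b])
    then have "\<phi> (Suc (Suc i)) b = 0"
      unfolding Suc free_module_iff by (intro poly_mapping_eqI) auto
    with b obtain r where "r \<in> free_module (as (Suc (Suc (Suc (Suc i)))))"
      "\<phi> (Suc (Suc (Suc i))) r = b"
      by (rule phi_exact)
    then show False using unit_vec_not_irrelevant[of r "Suc (Suc (Suc i))" 0 0 0] unfolding b_def by simp
  qed
qed

end

section \<open>The resolution of a staircase\<close>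

text \<open>Rows are swept upwards, and a row contributes its leftmost point only if that lies to
  the left of all earlier generators. The sweep may stop at a row reaching the least first
  coordinate, which is where finiteness comes from.\<close>

lemma staircase_exists:
  assumes A: "up_closed A" and ne: "A \<noteq> {}"
  obtains xs where "xs \<noteq> []" "sorted_wrt (\<lambda>p q. fst q < fst p \<and> snd p < snd q) xs"
    "A = {e. \<exists>p\<in>set xs. fst p \<le> fst e \<and> snd p \<le> snd e}"
proof -
  have step: "\<exists>xs. sorted_wrt (\<lambda>p q. fst q < fst p \<and> snd p < snd q) xs \<and> set xs \<subseteq> A \<and>
      (\<forall>p\<in>set xs. snd p < m) \<and> (\<forall>e\<in>A. snd e < m \<longrightarrow> (\<exists>p\<in>set xs. fst p \<le> fst e \<and> snd p \<le> snd e))" for m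
  proof (induction m)
    case 0
    show ?case by (rule exI[of _ "[]"]) simp
  next
    case (Suc m)
    then obtain xs where xs: "sorted_wrt (\<lambda>p q. fst q < fst p \<and> snd p < snd q) xs" "set xs \<subseteq> A"
      "\<And>p. p \<in> set xs \<Longrightarrow> snd p < m"
      "\<And>e. e \<in> A \<Longrightarrow> snd e < m \<Longrightarrow> \<exists>p\<in>set xs. fst p \<le> fst e \<and> snd p \<le> snd e" by blast
    define new where "new x \<longleftrightarrow> (x, m) \<in> A \<and> (\<forall>p\<in>set xs. x < fst p)" for x
    show ?case
    proof (cases "\<exists>x. new x")
      case False
      have "\<exists>p\<in>set xs. fst p \<le> fst e \<and> snd p \<le> snd e" if "e \<in> A" "snd e < Suc m" for e
      proof (cases "snd e < m")
        case True
        then show ?thesis using xs that by blast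
      next
        case snd: False
        then have "(fst e, m) \<in> A" using that by (cases e) (auto simp: less_Suc_eq)
        then obtain p where "p \<in> set xs" "fst p \<le> fst e" using False by (auto simp: new_def not_less)
        moreover from this have "snd p \<le> snd e" using xs(3)[of p] snd by simp
        ultimately show ?thesis by blast
      qed
      then show ?thesis using xs by (intro exI[of _ xs]) (auto simp: less_Suc_eq)
    next
      case True
      define x where "x = (LEAST x. new x)"
      have x: "new x" using LeastI_ex[OF True] by (simp add: x_def)
      have least: "x \<le> y" if "new y" for y using that by (simp add: x_def Least_le)
      have "\<exists>p\<in>set (xs @ [(x, m)]). fst p \<le> fst e \<and> snd p \<le> snd e" if "e \<in> A" "snd e < Suc m" for e
      proof (cases "snd e < m")
        case True
        then show ?thesis using xs that by auto
      next
        case snd: False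
        then have m: "snd e = m" using that by simp
        show ?thesis
        proof (cases "new (fst e)")
          case True
          from least[OF this] show ?thesis using m by auto
        next
          case False
          moreover have "(fst e, m) \<in> A" using that(1) m by (cases e) simp
          ultimately obtain p where "p \<in> set xs" "fst p \<le> fst e"
            by (auto simp: new_def not_less)
          moreover from this have "snd p \<le> snd e" using xs(3)[of p] m by simp
          ultimately show ?thesis by auto
        qed
      qed
      moreover have "sorted_wrt (\<lambda>p q. fst q < fst p \<and> snd p < snd q) (xs @ [(x, m)])"
        using xs x by (auto simp: sorted_wrt_append new_def)
      moreover have "set (xs @ [(x, m)]) \<subseteq> A" "\<forall>p\<in>set (xs @ [(x, m)]). snd p < Suc m"
        using xs x by (auto simp: new_def less_Suc_eq)
      ultimately show ?thesis by blast
    qed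
  qed
  define P where "P x \<longleftrightarrow> (\<exists>y. (x, y) \<in> A)" for x
  define x0 where "x0 = (LEAST x. P x)"
  have "\<exists>x. P x" using ne by (auto simp: P_def)
  from LeastI_ex[OF this] obtain y0 where y0: "(x0, y0) \<in> A" by (auto simp: P_def x0_def)
  have x0: "x0 \<le> fst e" if "e \<in> A" for e
    unfolding x0_def by (rule Least_le) (use that in \<open>cases e, auto simp: P_def\<close>)
  \<comment> \<open>Rows above \<open>y0\<close> add nothing: the sweep up to \<open>y0\<close>
    contains a point with first coordinate \<open>x0\<close>, which covers them.\<close>
  obtain xs where xs: "sorted_wrt (\<lambda>p q. fst q < fst p \<and> snd p < snd q) xs" "set xs \<subseteq> A"
    "\<And>e. e \<in> A \<Longrightarrow> snd e < Suc y0 \<Longrightarrow> \<exists>p\<in>set xs. fst p \<le> fst e \<and> snd p \<le> snd e"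
    using step[of "Suc y0"] by blast
  have cover: "\<exists>p\<in>set xs. fst p \<le> fst e \<and> snd p \<le> snd e" if "e \<in> A" for e
  proof (cases "snd e < Suc y0")
    case False
    obtain p where "p \<in> set xs" "fst p \<le> x0" "snd p \<le> y0" using xs(3)[OF y0] by auto
    then show ?thesis using False x0[OF that] by (intro bexI[of _ p]) auto
  qed (use xs that in blast)
  have "A = {e. \<exists>p\<in>set xs. fst p \<le> fst e \<and> snd p \<le> snd e}"
    using cover xs(2) up_closedD[OF A] by blast
  moreover have "xs \<noteq> []" using cover[OF y0] by auto
  ultimately show ?thesis using that xs(1) by blast
qed

lemma module_hom_linear_combination:
  assumes "module scale"
  shows "module_hom vec_scale scale (\<lambda>v. \<Sum>k<n. scale (Poly_Mapping.lookup v k) (g k))"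
proof -
  interpret m: module scale by fact
  have scale_scale: "scale (c * d) x = scale c (scale d x)" for c d x by simp
  show ?thesis
    by standard (simp_all add: lookup_add m.scale_left_distrib sum.distrib m.scale_sum_right)
qed

locale staircase =
  fixes xs :: "(nat \<times> nat) list"
  assumes ne: "xs \<noteq> []"
    and sorted: "sorted_wrt (\<lambda>p q. fst q < fst p \<and> snd p < snd q) xs"
begin

definition stair_set :: "(nat \<times> nat) set" where
  "stair_set = {e. \<exists>p\<in>set xs. fst p \<le> fst e \<and> snd p \<le> snd e}"

definition N :: nat where "N = length xs - 1"

text \<open>\<open>y_step k\<close> and \<open>x_step k\<close> are the exponents of the cofactors
  that take generators \<open>k\<close> and \<open>Suc k\<close> to their least common multiple; the
  truncated differences are exact for \<open>k < N\<close> by the strictness of the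
  staircase.\<close>

definition y_step :: "nat \<Rightarrow> nat \<times> nat" where "y_step k = (0, snd (xs ! Suc k) - snd (xs ! k))"
definition x_step :: "nat \<Rightarrow> nat \<times> nat" where "x_step k = (fst (xs ! k) - fst (xs ! Suc k), 0)"

definition relation :: "nat \<Rightarrow> (nat \<Rightarrow>\<^sub>0 'k::field poly2)" where
  "relation k = Poly_Mapping.single k (monom2 (y_step k)) - Poly_Mapping.single (Suc k) (monom2 (x_step k))"

definition augmentation :: "(nat \<Rightarrow>\<^sub>0 'k::field poly2) \<Rightarrow> 'k poly2" where
  "augmentation v = (\<Sum>k<length xs. Poly_Mapping.lookup v k * monom2 (xs ! k))"

definition syzygy_map :: "(nat \<Rightarrow>\<^sub>0 'k::field poly2) \<Rightarrow> (nat \<Rightarrow>\<^sub>0 'k poly2)" where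
  "syzygy_map v = (\<Sum>k<N. vec_scale (Poly_Mapping.lookup v k) (relation k))"

definition gen_degrees :: "int list" where "gen_degrees = map total_degree xs"

definition syzygy_degrees :: "int list" where
  "syzygy_degrees = map (\<lambda>k. int (fst (xs ! k) + snd (xs ! Suc k))) [0..<N]"

lemma length_degrees [simp]: "length gen_degrees = length xs" "length syzygy_degrees = N"
  by (simp_all add: gen_degrees_def syzygy_degrees_def)

lemma length_xs: "length xs = Suc N"
  using ne by (simp add: N_def)

lemma less: "i < j \<Longrightarrow> j < length xs \<Longrightarrow> fst (xs ! j) < fst (xs ! i) \<and> snd (xs ! i) < snd (xs ! j)"
  using sorted by (simp add: sorted_wrt_iff_nth_less)

lemma step_less: "k < N \<Longrightarrow> fst (xs ! Suc k) < fst (xs ! k) \<and> snd (xs ! k) < snd (xs ! Suc k)"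
  by (simp add: less length_xs)

lemma y_step_add: "k < N \<Longrightarrow> y_step k + xs ! k = (fst (xs ! k), snd (xs ! Suc k))"
  using step_less[of k] by (simp add: y_step_def prod_eq_iff)

lemma x_step_add: "k < N \<Longrightarrow> x_step k + xs ! Suc k = (fst (xs ! k), snd (xs ! Suc k))"
  using step_less[of k] by (simp add: x_step_def prod_eq_iff)

lemma up_closed_stair_set: "up_closed stair_set"
  unfolding up_closed_def stair_set_def by (auto intro: trans_le_add1)

lemma augmentation_hom: "module_hom vec_scale (*) augmentation"
  using module_hom_linear_combination[OF module_mult] by (simp add: augmentation_def[abs_def])

lemma syzygy_map_hom: "module_hom vec_scale vec_scale syzygy_map"
  using module_hom_linear_combination[OF vec.module_axioms] by (simp add: syzygy_map_def[abs_def])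

lemma lookup_relation:
  "Poly_Mapping.lookup (relation k) i = (monom2 (y_step k) when i = k) - (monom2 (x_step k) when i = Suc k)"
  by (auto simp: relation_def lookup_minus lookup_single when_def)

text \<open>The matrix of \<open>syzygy_map\<close> is bidiagonal: coordinate \<open>i\<close> meets
  only the relations \<open>i\<close> and \<open>i - 1\<close>. Coordinate 0 has no predecessor,
  whence the case distinction.\<close>

lemma lookup_syzygy_map:
  "Poly_Mapping.lookup (syzygy_map v) i =
    (Poly_Mapping.lookup v i * monom2 (y_step i) when i < N) -
    (case i of 0 \<Rightarrow> 0 | Suc k \<Rightarrow> Poly_Mapping.lookup v k * monom2 (x_step k) when k < N)"
proof -
  have "Poly_Mapping.lookup (syzygy_map v) i =
    (\<Sum>k<N. (Poly_Mapping.lookup v k * monom2 (y_step k) when i = k)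
      - (Poly_Mapping.lookup v k * monom2 (x_step k) when i = Suc k))"
    by (simp add: syzygy_map_def lookup_sum lookup_relation right_diff_distrib mult_when)
  also have "\<dots> = (\<Sum>k<N. (if i = k then Poly_Mapping.lookup v i * monom2 (y_step i) else 0))
      - (\<Sum>k<N. (Poly_Mapping.lookup v k * monom2 (x_step k) when i = Suc k))"
    unfolding sum_subtractf by (simp add: when_def if_distrib cong: if_cong)
  also have "(\<Sum>k<N. (Poly_Mapping.lookup v k * monom2 (x_step k) when i = Suc k))
    = (case i of 0 \<Rightarrow> 0 | Suc k \<Rightarrow> Poly_Mapping.lookup v k * monom2 (x_step k) when k < N)"
    by (cases i) (auto simp: when_def)
  finally show ?thesis by (simp add: when_def)
qed

lemma augmentation_relation: "k < N \<Longrightarrow> augmentation (relation k) = 0"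
proof -
  assume k: "k < N"
  have "augmentation (relation k) = (\<Sum>i<length xs. (monom2 (y_step k) * monom2 (xs ! k) when i = k)
     - (monom2 (x_step k) * monom2 (xs ! Suc k) when i = Suc k))"
    unfolding augmentation_def by (rule sum.cong) (auto simp: lookup_relation when_def)
  also have "\<dots> = monom2 (y_step k) * monom2 (xs ! k) - monom2 (x_step k) * monom2 (xs ! Suc k)"
    using k by (simp add: sum_subtractf when_def length_xs)
  finally show ?thesis by (simp add: monom2_mult y_step_add[OF k] x_step_add[OF k])
qed

lemma syzygy_map_in_free_module: "syzygy_map v \<in> free_module gen_degrees"
  by (auto simp: free_module_iff lookup_syzygy_map when_def length_xs split: nat.splits)

lemma augmentation_syzygy_map: "augmentation (syzygy_map v) = 0"
proof -
  interpret a: module_hom vec_scale "(*)" augmentation by (rule augmentation_hom)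
  show ?thesis unfolding syzygy_map_def a.sum a.scale by (simp add: augmentation_relation)
qed

text \<open>The last coefficient of a syzygy is divisible by the \<open>x\<close>-step in front of it, because every
  other generator has a larger power of \<open>x\<close>.\<close>

lemma syzygy_exact:
  fixes v :: "nat \<Rightarrow>\<^sub>0 'k::field poly2"
  assumes "m \<le> length xs" "Poly_Mapping.keys v \<subseteq> {..<m}" "augmentation v = 0"
  shows "\<exists>c. Poly_Mapping.keys c \<subseteq> {..<N} \<and> syzygy_map c = v"
  using assms
proof (induction m arbitrary: v)
  case 0
  then have "v = 0" by simp
  then show ?case using module_hom.zero[OF syzygy_map_hom] by (intro exI[of _ 0]) simp
next
  case (Suc m)
  let ?v = "Poly_Mapping.lookup v"
  have zero: "?v k = 0" if "m < k" for k
    using Suc.prems(2) that by (meson in_keys_iff lessThan_iff less_Suc_eq_le linorder_not_le subsetD)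
  have "augmentation v = ?v m * monom2 (xs ! m) + (\<Sum>k\<in>{..<length xs} - {m}. ?v k * monom2 (xs ! k))"
    unfolding augmentation_def using Suc.prems(1) by (subst sum.remove[of _ m]) auto
  also have "(\<Sum>k\<in>{..<length xs} - {m}. ?v k * monom2 (xs ! k)) = (\<Sum>k<m. ?v k * monom2 (xs ! k))"
    using zero Suc.prems(1) by (intro sum.mono_neutral_right) (auto simp: not_less)
  finally have eq: "?v m * monom2 (xs ! m) = - (\<Sum>k<m. ?v k * monom2 (xs ! k))"
    using Suc.prems(3) by (simp add: eq_neg_iff_add_eq_0)
  show ?case
  proof (cases m)
    case 0
    then have "?v m = 0" using eq by (simp add: mult.commute)
    then have "Poly_Mapping.keys v \<subseteq> {..<m}"
      using Suc.prems(2) by (auto simp: less_Suc_eq subset_iff)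
    then show ?thesis using Suc by simp
  next
    case (Suc m')
    then have m': "m' < N" using Suc.prems(1) by (simp add: length_xs)
    \<comment> \<open>The exponent of x at \<open>m'\<close> is the smallest among the generators
      before \<open>m\<close>, so \<open>?B\<close> contains all of them.\<close>
    let ?B = "{e :: nat \<times> nat. fst (xs ! m') \<le> fst e}"
    have B: "is_ideal (mon_ideal ?B :: 'k poly2 set)"
      by (rule mon_ideal_is_ideal) (auto simp: up_closed_def)
    have "(\<Sum>k<m. ?v k * monom2 (xs ! k)) \<in> mon_ideal ?B"
    proof (rule is_ideal_sum[OF B])
      fix k assume "k \<in> {..<m}"
      then have "fst (xs ! m') \<le> fst (xs ! k)"
        using less[of k m'] m' Suc by (cases "k = m'") (auto simp: length_xs)
      then have "monom2 (xs ! k) \<in> (mon_ideal ?B :: 'k poly2 set)" by simp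
      then show "?v k * monom2 (xs ! k) \<in> mon_ideal ?B" using B by (auto simp: is_ideal_def)
    qed
    then have "monom2 (xs ! m) * ?v m \<in> mon_ideal ?B"
      using eq by (simp add: mon_ideal_def in_keys_iff subset_iff mult.commute)
    then have "Poly_Mapping.keys (?v m) \<subseteq> range ((+) (x_step m'))"
      unfolding x_step_def range_plus_pair using Suc by (auto simp: mon_ideal_def keys_monom2_mult)
    from monom2_mult_shift[OF this] obtain q where q: "?v m = monom2 (x_step m') * q" by metis
    \<comment> \<open>The relation carries \<open>- monom2 (x_step m')\<close> in coordinate
      \<open>m\<close>, so adding it \<open>q\<close> times cancels that coordinate; apart from it
      only coordinate \<open>m'\<close> changes.\<close>
    define v' where "v' = v + vec_scale q (relation m')"
    have "Poly_Mapping.keys v' \<subseteq> {..<m}"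
    proof
      fix k assume k: "k \<in> Poly_Mapping.keys v'"
      have "Poly_Mapping.lookup v' k = 0" if "m \<le> k"
        using zero[of k] that q Suc by (cases "k = m") (auto simp: v'_def lookup_add lookup_relation when_def)
      then show "k \<in> {..<m}" using k by (auto simp: in_keys_iff not_less[symmetric])
    qed
    moreover have "augmentation v' = 0"
      unfolding v'_def module_hom.add[OF augmentation_hom] module_hom.scale[OF augmentation_hom]
      using Suc.prems(3) by (simp add: augmentation_relation[OF m'])
    ultimately obtain c where c: "Poly_Mapping.keys c \<subseteq> {..<N}" "syzygy_map c = v'"
      using Suc.IH Suc.prems(1) Suc_leD by blast
    have "syzygy_map (Poly_Mapping.single m' q) = vec_scale q (relation m')"
    proof -
      have "syzygy_map (Poly_Mapping.single m' q) = (\<Sum>k<N. if k = m' then vec_scale q (relation m') else 0)"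
        unfolding syzygy_map_def by (rule sum.cong) (auto simp: lookup_single when_def)
      then show ?thesis using m' by simp
    qed
    then have "syzygy_map (c - Poly_Mapping.single m' q) = v"
      using c by (simp add: module_hom.diff[OF syzygy_map_hom] v'_def)
    moreover have "Poly_Mapping.keys (c - Poly_Mapping.single m' q) \<subseteq> {..<N}"
    proof
      fix k assume "k \<in> Poly_Mapping.keys (c - Poly_Mapping.single m' q)"
      then have "k \<in> Poly_Mapping.keys c \<or> k = m'"
        by (auto simp: in_keys_iff lookup_minus lookup_single when_def split: if_splits)
      then show "k \<in> {..<N}" using c m' by auto
    qed
    ultimately show ?thesis by blast
  qed
qed

text \<open>Forward substitution in the bidiagonal matrix: once the preceding coefficient is zero,
  the next one is annihilated by a monomial.\<close>

lemma syzygy_map_injective: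
  assumes "Poly_Mapping.keys c \<subseteq> {..<N}" "syzygy_map c = 0"
  shows "c = 0"
proof (rule poly_mapping_eqI)
  fix k
  have "Poly_Mapping.lookup c k = 0"
  proof (induction k)
    case 0
    have "(Poly_Mapping.lookup c 0 * monom2 (y_step 0) when 0 < N) = 0"
      using lookup_syzygy_map[of c 0] assms(2) by simp
    then show ?case using assms(1) by (cases "0 < N") (auto simp: mult.commute in_keys_iff)
  next
    case (Suc k)
    have "(Poly_Mapping.lookup c (Suc k) * monom2 (y_step (Suc k)) when Suc k < N) = 0"
      using lookup_syzygy_map[of c "Suc k"] assms(2) Suc by simp
    then show ?case using assms(1)
      by (cases "Suc k < N") (auto simp: mult.commute in_keys_iff subset_iff)
  qed
  then show "Poly_Mapping.lookup c k = Poly_Mapping.lookup 0 k" by simp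
qed

lemma augmentation_image: "augmentation ` free_module gen_degrees = (mon_ideal stair_set :: 'k::field poly2 set)"
proof
  note ideal = mon_ideal_is_ideal[OF up_closed_stair_set, where 'k = 'k]
  have gen: "monom2 (xs ! k) \<in> (mon_ideal stair_set :: 'k poly2 set)" if "k < length xs" for k
    using that by (auto simp: stair_set_def)
  show "augmentation ` free_module gen_degrees \<subseteq> (mon_ideal stair_set :: 'k poly2 set)"
    unfolding augmentation_def using gen ideal
    by (auto intro!: is_ideal_sum[OF ideal] simp: is_ideal_def)
  have "stair_set \<subseteq> {e + u | e u. e \<in> set xs}"
  proof
    fix e assume "e \<in> stair_set"
    then obtain p where "p \<in> set xs" "fst p \<le> fst e" "snd p \<le> snd e" by (auto simp: stair_set_def)
    moreover from this have "e = p + (fst e - fst p, snd e - snd p)" by (simp add: prod_eq_iff)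
    ultimately show "e \<in> {e + u | e u. e \<in> set xs}" by blast
  qed
  then have "mon_ideal stair_set \<subseteq> (mon_ideal {e + u | e u. e \<in> set xs} :: 'k poly2 set)"
    unfolding mon_ideal_def by blast
  also have "\<dots> = module.span (*) (monom2 ` set xs)" by (rule span_monom2[symmetric])
  also have "\<dots> \<subseteq> augmentation ` free_module gen_degrees"
  proof (rule ideal_span_minimal)
    show "is_ideal (augmentation ` free_module gen_degrees)"
      by (rule module_hom.subspace_image[OF augmentation_hom]) (auto simp: vec.subspace_def)
    show "monom2 ` set xs \<subseteq> (augmentation ` free_module gen_degrees :: 'k poly2 set)"
    proof
      fix p :: "'k poly2" assume "p \<in> monom2 ` set xs"
      then obtain k where k: "k < length xs" "p = monom2 (xs ! k)" by (auto simp: in_set_conv_nth)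
      have "augmentation (Poly_Mapping.single k 1) = (\<Sum>i<length xs. if i = k then p else 0)"
        unfolding augmentation_def by (rule sum.cong) (auto simp: lookup_single when_def k)
      then have "augmentation (Poly_Mapping.single k 1) = p" using k by simp
      moreover have "Poly_Mapping.single k 1 \<in> (free_module gen_degrees :: (nat \<Rightarrow>\<^sub>0 'k poly2) set)"
        using k by (auto simp: free_module_iff lookup_single when_def)
      ultimately show "p \<in> augmentation ` free_module gen_degrees" by blast
    qed
  qed
  finally show "mon_ideal stair_set \<subseteq> (augmentation ` free_module gen_degrees :: 'k poly2 set)" .
qed

definition betti_degrees :: "nat \<Rightarrow> int list" where
  "betti_degrees i = (if i = 0 then gen_degrees else if i = 1 then syzygy_degrees else [])"

definition differential :: "nat \<Rightarrow> (nat \<Rightarrow>\<^sub>0 'k::field poly2) \<Rightarrow> (nat \<Rightarrow>\<^sub>0 'k poly2)" where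
  "differential i = (if i = 0 then syzygy_map else (\<lambda>_. 0))"

lemma augmentation_graded:
  assumes "v \<in> free_part gen_degrees d"
  shows "augmentation v \<in> homogeneous_part d"
proof -
  have hom_sum: "sum f X \<in> homogeneous_part d" if "\<And>k. k \<in> X \<Longrightarrow> f k \<in> homogeneous_part d"
    for f :: "nat \<Rightarrow> 'a poly2" and X
    using that by (induction X rule: infinite_finite_induct) (auto simp: homogeneous_part_add)
  show ?thesis unfolding augmentation_def
  proof (rule hom_sum)
    fix k assume "k \<in> {..<length xs}"
    then have "Poly_Mapping.lookup v k \<in> homogeneous_part (d - total_degree (xs ! k))"
      using assms by (auto simp: free_part_iff gen_degrees_def)
    from homogeneous_part_mult[OF this homogeneous_part_monom2[OF refl], of "xs ! k"]
    show "Poly_Mapping.lookup v k * monom2 (xs ! k) \<in> homogeneous_part d" by simp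
  qed
qed

lemma syzygy_map_graded:
  fixes v :: "nat \<Rightarrow>\<^sub>0 'k::field poly2"
  assumes "v \<in> free_part syzygy_degrees d"
  shows "syzygy_map v \<in> free_part gen_degrees d"
  unfolding free_part_iff
proof (intro conjI allI impI)
  show "syzygy_map v \<in> free_module gen_degrees" by (rule syzygy_map_in_free_module)
  fix i assume "i < length gen_degrees"
  then have i: "gen_degrees ! i = total_degree (xs ! i)" by (simp add: gen_degrees_def)
  have v: "Poly_Mapping.lookup v k \<in> homogeneous_part (d - int (fst (xs ! k) + snd (xs ! Suc k)))"
    if "k < N" for k
    using assms that by (auto simp: free_part_iff syzygy_degrees_def)
  have y: "Poly_Mapping.lookup v k * monom2 (y_step k) \<in> homogeneous_part (d - total_degree (xs ! k))" if "k < N" for k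
  proof -
    have "d - int (fst (xs ! k) + snd (xs ! Suc k)) + total_degree (y_step k) = d - total_degree (xs ! k)"
      using step_less[OF that] by (simp add: y_step_def of_nat_diff)
    then show ?thesis
      using homogeneous_part_mult[OF v[OF that] homogeneous_part_monom2[OF refl, of "y_step k"]] by metis
  qed
  have x: "Poly_Mapping.lookup v k * monom2 (x_step k) \<in> homogeneous_part (d - total_degree (xs ! Suc k))" if "k < N" for k
  proof -
    have "d - int (fst (xs ! k) + snd (xs ! Suc k)) + total_degree (x_step k) = d - total_degree (xs ! Suc k)"
      using step_less[OF that] by (simp add: x_step_def of_nat_diff)
    then show ?thesis
      using homogeneous_part_mult[OF v[OF that] homogeneous_part_monom2[OF refl, of "x_step k"]] by metis
  qed
  show "Poly_Mapping.lookup (syzygy_map v) i \<in> homogeneous_part (d - gen_degrees ! i)"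
    unfolding lookup_syzygy_map i
  proof (rule homogeneous_part_diff)
    show "(Poly_Mapping.lookup v i * monom2 (y_step i) when i < N) \<in> homogeneous_part (d - total_degree (xs ! i))"
      using y[of i] by (auto simp: when_def)
    show "(case i of 0 \<Rightarrow> 0 | Suc k \<Rightarrow> Poly_Mapping.lookup v k * monom2 (x_step k) when k < N)
      \<in> homogeneous_part (d - total_degree (xs ! i))"
      using x[of "i - 1"] by (auto simp: when_def split: nat.splits)
  qed
qed

text \<open>The staircase is strict, so both step monomials are nonconstant.\<close>

lemma syzygy_map_minimal:
  fixes v :: "nat \<Rightarrow>\<^sub>0 'k::field poly2"
  shows "Poly_Mapping.lookup (syzygy_map v) k \<in> irrelevant_ideal"
proof -
  have I: "is_ideal (irrelevant_ideal :: 'k poly2 set)" unfolding irrelevant_ideal_def by (rule is_ideal_span)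
  have "monom2 (y_step k) \<in> (irrelevant_ideal :: 'k poly2 set)"
    "monom2 (x_step k) \<in> (irrelevant_ideal :: 'k poly2 set)" if "k < N" for k
    using step_less[OF that]
    by (auto simp: irrelevant_ideal_iff monom2_def lookup_single when_def y_step_def x_step_def zero_prod_def)
  then show ?thesis
    unfolding lookup_syzygy_map using I
    by (intro is_ideal_diff[OF I]) (auto simp: is_ideal_def when_def split: nat.splits)
qed

lemma resolution_stair_set:
  "graded_module.minimal_graded_free_resolution (*) (mon_ideal stair_set :: 'k::field poly2 set)
    (\<lambda>d. mon_ideal stair_set \<inter> homogeneous_part d) betti_degrees augmentation differential"
  unfolding graded_module.minimal_graded_free_resolution_def[OF graded_module_mon_ideal[OF up_closed_stair_set]]
proof (intro conjI allI ballI)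
  have zero_hom: "module_hom vec_scale vec_scale (\<lambda>_. 0 :: nat \<Rightarrow>\<^sub>0 'k poly2)"
    by standard auto
  show "module_hom vec_scale (*) augmentation" by (rule augmentation_hom)
  show "module_hom vec_scale vec_scale (differential i :: (nat \<Rightarrow>\<^sub>0 'k poly2) \<Rightarrow> _)" for i
    using zero_hom by (auto simp: differential_def intro: syzygy_map_hom)
  show "augmentation ` free_part (betti_degrees 0) d \<subseteq> (mon_ideal stair_set \<inter> homogeneous_part d :: 'k poly2 set)" for d
  proof (rule image_subsetI)
    fix v :: "nat \<Rightarrow>\<^sub>0 'k poly2" assume "v \<in> free_part (betti_degrees 0) d"
    then have v: "v \<in> free_part gen_degrees d" by (simp add: betti_degrees_def)
    have "augmentation v \<in> mon_ideal stair_set"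
      unfolding augmentation_image[symmetric] using free_part_subset[OF v] by (rule imageI)
    with augmentation_graded[OF v] show "augmentation v \<in> mon_ideal stair_set \<inter> homogeneous_part d" by simp
  qed
  show "differential i ` free_part (betti_degrees (Suc i)) d \<subseteq> (free_part (betti_degrees i) d :: (nat \<Rightarrow>\<^sub>0 'k poly2) set)" for i d
  proof (rule image_subsetI)
    fix v :: "nat \<Rightarrow>\<^sub>0 'k poly2" assume "v \<in> free_part (betti_degrees (Suc i)) d"
    then show "differential i v \<in> free_part (betti_degrees i) d"
      using syzygy_map_graded[of v d]
      by (cases i) (auto simp: differential_def betti_degrees_def free_part_iff)
  qed
  show "augmentation ` free_module (betti_degrees 0) = (mon_ideal stair_set :: 'k poly2 set)"
    by (simp add: betti_degrees_def augmentation_image)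
  show "{v \<in> free_module (betti_degrees 0). augmentation v = 0} =
    (differential 0 ` free_module (betti_degrees 1) :: (nat \<Rightarrow>\<^sub>0 'k poly2) set)"
  proof (intro set_eqI iffI)
    fix v :: "nat \<Rightarrow>\<^sub>0 'k poly2" assume "v \<in> {v \<in> free_module (betti_degrees 0). augmentation v = 0}"
    then have "Poly_Mapping.keys v \<subseteq> {..<length xs}" "augmentation v = 0"
      by (auto simp: betti_degrees_def free_module_def)
    from syzygy_exact[OF order_refl this]
    obtain c where "Poly_Mapping.keys c \<subseteq> {..<N}" "syzygy_map c = v" by blast
    then show "v \<in> differential 0 ` free_module (betti_degrees 1)"
      by (auto simp: differential_def betti_degrees_def free_module_def)
  next
    fix v :: "nat \<Rightarrow>\<^sub>0 'k poly2" assume "v \<in> differential 0 ` free_module (betti_degrees 1)"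
    then show "v \<in> {v \<in> free_module (betti_degrees 0). augmentation v = 0}"
      by (auto simp: differential_def betti_degrees_def syzygy_map_in_free_module augmentation_syzygy_map)
  qed
  show "{v \<in> free_module (betti_degrees (Suc i)). differential i v = 0} =
    (differential (Suc i) ` free_module (betti_degrees (Suc (Suc i))) :: (nat \<Rightarrow>\<^sub>0 'k poly2) set)" for i
  proof -
    have empty: "free_module [] = ({0} :: (nat \<Rightarrow>\<^sub>0 'k poly2) set)" by (auto simp: free_module_def)
    have "{v \<in> free_module (betti_degrees (Suc i)). differential i v = 0} = ({0} :: (nat \<Rightarrow>\<^sub>0 'k poly2) set)"
    proof (cases i)
      case 0
      then show ?thesis
        using syzygy_map_injective module_hom.zero[OF syzygy_map_hom]
        by (auto simp: betti_degrees_def differential_def free_module_def)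
    qed (auto simp: betti_degrees_def differential_def empty)
    then show ?thesis by (simp add: betti_degrees_def differential_def empty)
  qed
  show "Poly_Mapping.lookup (differential i v) k \<in> irrelevant_ideal" for i k and v :: "nat \<Rightarrow>\<^sub>0 'k poly2"
    by (auto simp: differential_def syzygy_map_minimal) (simp add: irrelevant_ideal_iff)
qed

end

section \<open>Regularity of monomial ideals\<close>

text \<open>The values j - i: generators sit at i = 0, corners at i = 1 with j = deg w + 2, whence
  the + 1.\<close>

definition reg_degrees :: "(nat \<times> nat) set \<Rightarrow> int set" where
  "reg_degrees A = total_degree ` min_gens A \<union> (\<lambda>w. total_degree w + 1) ` corners A"

lemma min_gens_nonempty:
  assumes "A \<noteq> {}"
  shows "min_gens A \<noteq> {}"
proof -
  obtain e where e: "e \<in> A" "\<And>a. a \<in> A \<Longrightarrow> fst e + snd e \<le> fst a + snd a"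
    using ex_has_least_nat[of "\<lambda>e. e \<in> A" _ "\<lambda>e. fst e + snd e"] assms by blast
  have "e \<in> min_gens A"
    unfolding min_gens_def using e by fastforce
  then show ?thesis by blast
qed

lemma minimal_resolution_exists:
  assumes "up_closed A" "A \<noteq> {}"
  shows "\<exists>as \<epsilon> \<phi>. graded_module.minimal_graded_free_resolution (*) (mon_ideal A :: 'k::field poly2 set)
    (\<lambda>d. mon_ideal A \<inter> homogeneous_part d) as \<epsilon> \<phi>"
proof -
  obtain xs where xs: "xs \<noteq> []" "sorted_wrt (\<lambda>p q. fst q < fst p \<and> snd p < snd q) xs"
    "A = {e. \<exists>p\<in>set xs. fst p \<le> fst e \<and> snd p \<le> snd e}"
    using assms by (rule staircase_exists)
  interpret staircase xs by standard (use xs in auto)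
  have "A = stair_set" by (simp add: stair_set_def xs)
  then show ?thesis using resolution_stair_set by blast
qed

lemma
  assumes A: "up_closed A" and ne: "A \<noteq> {}"
  shows ideal_regularity_mon_ideal: "ideal_regularity (mon_ideal A :: 'k::field poly2 set) = Max (reg_degrees A)"
    and finite_reg_degrees: "finite (reg_degrees A)"
proof -
  let ?G = "\<lambda>d. mon_ideal A \<inter> homogeneous_part d :: 'k poly2 set"
  let ?res = "graded_module.minimal_graded_free_resolution (*) (mon_ideal A :: 'k poly2 set) ?G"
  let ?betti = "graded_module.graded_betti (*) (mon_ideal A :: 'k poly2 set) ?G"
  note gm = graded_module_mon_ideal[OF A, where 'k = 'k]
  define as where "as = (SOME as. \<exists>\<epsilon> \<phi>. ?res as \<epsilon> \<phi>)"
  have "\<exists>\<epsilon> \<phi>. ?res as \<epsilon> \<phi>"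
    unfolding as_def by (rule someI_ex[OF minimal_resolution_exists[OF A ne]])
  then obtain \<epsilon> \<phi> where "?res as \<epsilon> \<phi>" by blast
  with A interpret R: mon_ideal_resolution A as \<epsilon> \<phi>
    by (rule mon_ideal_resolution.intro)
  have betti: "?betti i j \<noteq> 0 \<longleftrightarrow> j \<in> set (as i)" for i j
    by (simp add: graded_module.graded_betti_def[OF gm] as_def[symmetric] count_list_0_iff)
  have gens: "set (as 0) = total_degree ` min_gens A"
    using R.betti0_imp_min_gen R.min_gen_imp_betti0 by blast
  have syz: "set (as 1) = (\<lambda>w. total_degree w + 2) ` corners A"
    using R.betti1_imp_corner R.corner_imp_betti1 by blast
  have cases: "j \<in> set (as i) \<longleftrightarrow> (i = 0 \<and> j \<in> set (as 0)) \<or> (i = 1 \<and> j \<in> set (as 1))" for i j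
  proof (cases i)
    case (Suc i')
    then show ?thesis by (cases i') (simp_all add: R.betti_empty)
  qed simp
  have "t \<in> {j - int i | i j. ?betti i j \<noteq> 0} \<longleftrightarrow> t \<in> set (as 0) \<union> (\<lambda>j. j - 1) ` set (as 1)" for t
  proof
    assume "t \<in> {j - int i | i j. ?betti i j \<noteq> 0}"
    then obtain i j where ij: "t = j - int i" "j \<in> set (as i)" unfolding betti by blast
    from iffD1[OF cases ij(2)] ij(1) show "t \<in> set (as 0) \<union> (\<lambda>j. j - 1) ` set (as 1)" by auto
  next
    assume "t \<in> set (as 0) \<union> (\<lambda>j. j - 1) ` set (as 1)"
    then obtain i j where "t = j - int i" "j \<in> set (as i)"
    proof (elim UnE imageE)
      assume "t \<in> set (as 0)"
      then show ?thesis using that[of t 0] by simp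
    next
      fix j assume "t = j - 1" "j \<in> set (as 1)"
      then show ?thesis using that[of j 1] by simp
    qed
    then show "t \<in> {j - int i | i j. ?betti i j \<noteq> 0}" unfolding betti by blast
  qed
  then have "{j - int i | i j. ?betti i j \<noteq> 0} = set (as 0) \<union> (\<lambda>j. j - 1) ` set (as 1)"
    by (rule set_eqI)
  also have "\<dots> = reg_degrees A"
    unfolding gens syz reg_degrees_def image_image by (simp add: add.commute)
  finally have eq: "{j - int i | i j. ?betti i j \<noteq> 0} = reg_degrees A" .
  show "ideal_regularity (mon_ideal A :: 'k poly2 set) = Max (reg_degrees A)"
    unfolding ideal_regularity_def graded_module.regularity_def[OF gm] eq ..
  have "reg_degrees A = set (as 0) \<union> (\<lambda>j. j - 1) ` set (as 1)"
    unfolding gens syz reg_degrees_def image_image by (simp add: add.commute)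
  then show "finite (reg_degrees A)" by simp
qed

text \<open>Points outside \<open>A\<close> that dominate \<open>w\<close> have first coordinate
  below that of \<open>q\<close> and second below that of \<open>p\<close>, so one of maximal total
  degree exists; both of its upper neighbours must then lie in \<open>A\<close>.\<close>

lemma corner_above:
  assumes A: "up_closed A" and w: "w \<notin> A"
    and p: "p \<in> A" "fst p \<le> fst w" and q: "q \<in> A" "snd q \<le> snd w"
  obtains c where "c \<in> corners A" "fst w \<le> fst c" "snd w \<le> snd c"
proof -
  define P where "P c \<longleftrightarrow> c \<notin> A \<and> fst w \<le> fst c \<and> snd w \<le> snd c" for c
  have bound: "fst c + snd c < fst q + snd p" if "P c" for c
  proof -
    have "fst c < fst q"
      using that q up_closedD[OF A q(1), of c] by (auto simp: P_def not_le[symmetric])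
    moreover have "snd c < snd p"
      using that p up_closedD[OF A p(1), of c] by (auto simp: P_def not_le[symmetric])
    ultimately show ?thesis by simp
  qed
  have "P w" using w by (simp add: P_def)
  then obtain c where c: "P c" "\<And>d. P d \<Longrightarrow> fst d + snd d \<le> fst c + snd c"
    using ex_has_greatest_nat[of P w "\<lambda>c. fst c + snd c" "fst q + snd p"] bound less_imp_le by blast
  have "(1, 0) + c \<in> A" using c(1) c(2)[of "(1, 0) + c"] by (auto simp: P_def)
  moreover have "(0, 1) + c \<in> A" using c(1) c(2)[of "(0, 1) + c"] by (auto simp: P_def)
  ultimately have "c \<in> corners A" using c(1) by (simp add: corners_def P_def)
  then show ?thesis using that c(1) by (simp add: P_def)
qed

text \<open>A corner \<open>w\<close> of \<open>B\<close> lies outside \<open>A\<close>, so one reaches a corner of \<open>A\<close> by increasing \<open>w\<close>; a minimal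
  generator of \<open>B\<close> other than the common divisor of \<open>A\<close> has a lower neighbour outside \<open>A\<close>, from
  which the same argument applies.\<close>

lemma reg_degrees_mono:
  assumes A: "up_closed A" "A \<noteq> {}" and B: "up_closed B" and sub: "A \<subseteq> B"
    and fst: "\<And>e. e \<in> B \<Longrightarrow> \<exists>a\<in>A. fst a \<le> fst e" and snd: "\<And>e. e \<in> B \<Longrightarrow> \<exists>a\<in>A. snd a \<le> snd e"
    and t: "t \<in> reg_degrees B"
  shows "\<exists>s\<in>reg_degrees A. t \<le> s"
proof -
  have up: "\<exists>s\<in>reg_degrees A. total_degree w + 1 \<le> s"
    if w: "w \<notin> B" and p: "\<exists>p\<in>A. fst p \<le> fst w" and q: "\<exists>q\<in>A. snd q \<le> snd w" for w
  proof -
    have "w \<notin> A" using w sub by blast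
    moreover obtain p q where "p \<in> A" "fst p \<le> fst w" "q \<in> A" "snd q \<le> snd w" using p q by blast
    ultimately obtain c where "c \<in> corners A" "fst w \<le> fst c" "snd w \<le> snd c"
      using corner_above[OF A(1)] by metis
    then show ?thesis by (intro bexI[of _ "total_degree c + 1"]) (auto simp: reg_degrees_def)
  qed
  from t consider e where "e \<in> min_gens B" "t = total_degree e"
    | w where "w \<in> corners B" "t = total_degree w + 1"
    by (auto simp: reg_degrees_def)
  then show ?thesis
  proof cases
    case 2
    then have "w \<notin> B" "(1, 0) + w \<in> B" "(0, 1) + w \<in> B" by (auto simp: corners_def)
    \<comment> \<open>Raising only the second coordinate keeps \<open>fst w\<close>, so the
      hypothesis on first coordinates can be applied to a point of \<open>B\<close>; likewise with
      the roles exchanged.\<close>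
    then show ?thesis using up[of w] fst[of "(0, 1) + w"] snd[of "(1, 0) + w"] 2 by auto
  next
    case 1
    then have e: "e \<in> B" "\<And>a. a \<in> B \<Longrightarrow> (1, 0) + a \<noteq> e \<and> (0, 1) + a \<noteq> e"
      by (auto simp: min_gens_def)
    obtain p q where p: "p \<in> A" "fst p \<le> fst e" and q: "q \<in> A" "snd q \<le> snd e"
      using fst[OF e(1)] snd[OF e(1)] by blast
    show ?thesis
    proof (cases "(\<forall>a\<in>A. fst e \<le> fst a) \<and> (\<forall>a\<in>A. snd e \<le> snd a)")
      case True
      obtain g where g: "g \<in> min_gens A" using min_gens_nonempty[OF A(2)] by blast
      then have "t \<le> total_degree g" using True 1 by (auto simp: min_gens_def intro: add_mono)
      then show ?thesis using g by (auto simp: reg_degrees_def)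
    next
      case False
      then consider a where "a \<in> A" "fst a < fst e" | a where "a \<in> A" "snd a < snd e"
        by (auto simp: not_le)
      then show ?thesis
      proof cases
        case (1 a)
        \<comment> \<open>\<open>w\<close> is outside \<open>B\<close> by minimality of
          \<open>e\<close>, and \<open>a\<close> witnesses that a point of \<open>A\<close> is still
          not to the right of \<open>w\<close>.\<close>
        define w where "w = (fst e - 1, snd e)"
        have w: "(1, 0) + w = e" using 1 by (simp add: w_def prod_eq_iff)
        have "fst a \<le> fst w" "snd q \<le> snd w" using 1 q by (simp_all add: w_def)
        then have "\<exists>s\<in>reg_degrees A. total_degree w + 1 \<le> s"
          using up[of w] e(2)[of w] w 1 q by blast
        moreover have "t = total_degree w + 1" unfolding \<open>t = total_degree e\<close> w[symmetric] by simp
        ultimately show ?thesis by simp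
      next
        case (2 a)
        define w where "w = (fst e, snd e - 1)"
        have w: "(0, 1) + w = e" using 2 by (simp add: w_def prod_eq_iff)
        have "snd a \<le> snd w" "fst p \<le> fst w" using 2 p by (simp_all add: w_def)
        then have "\<exists>s\<in>reg_degrees A. total_degree w + 1 \<le> s"
          using up[of w] e(2)[of w] w 2 p by blast
        moreover have "t = total_degree w + 1" unfolding \<open>t = total_degree e\<close> w[symmetric] by simp
        ultimately show ?thesis by simp
      qed
    qed
  qed
qed

lemma ideal_regularity_mon_ideal_mono:
  assumes "up_closed A" "A \<noteq> {}" "up_closed B" "A \<subseteq> B"
    and "\<And>e. e \<in> B \<Longrightarrow> \<exists>a\<in>A. fst a \<le> fst e" "\<And>e. e \<in> B \<Longrightarrow> \<exists>a\<in>A. snd a \<le> snd e"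
  shows "ideal_regularity (mon_ideal B :: 'k::field poly2 set) \<le> ideal_regularity (mon_ideal A :: 'k poly2 set)"
proof -
  have B: "B \<noteq> {}" using assms by blast
  have "reg_degrees B \<noteq> {}" using min_gens_nonempty[OF B] by (auto simp: reg_degrees_def)
  moreover have "t \<le> Max (reg_degrees A)" if t: "t \<in> reg_degrees B" for t
  proof -
    obtain s where "s \<in> reg_degrees A" "t \<le> s" using reg_degrees_mono[OF assms t] by blast
    then show ?thesis using finite_reg_degrees[OF assms(1,2)] by (meson Max_ge order_trans)
  qed
  ultimately show ?thesis
    unfolding ideal_regularity_mon_ideal[OF assms(1,2)] ideal_regularity_mon_ideal[OF assms(3) B]
    using finite_reg_degrees[OF assms(3) B] by simp
qed

section \<open>The Newton polygon\<close>

text \<open>The lattice points of r conv(G) plus the nonnegative quadrant, i.e. of the Newton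
  polyhedron dilated by r. The value r = 1 describes the integral closure, r = \<open>card G\<close>
  the ideal on which Cayley-Hamilton is used.\<close>

definition newton :: "(nat \<times> nat) set \<Rightarrow> real \<Rightarrow> (nat \<times> nat) set" where
  "newton G r = {e. \<exists>c :: nat \<times> nat \<Rightarrow> real. (\<forall>a\<in>G. 0 \<le> c a) \<and> (\<Sum>a\<in>G. c a) = r \<and>
     (\<Sum>a\<in>G. c a * real (fst a)) \<le> real (fst e) \<and> (\<Sum>a\<in>G. c a * real (snd a)) \<le> real (snd e)}"

lemma up_closed_newton: "up_closed (newton G r)"
  unfolding up_closed_def
proof (intro ballI allI)
  fix e u assume "e \<in> newton G r"
  then obtain c :: "nat \<times> nat \<Rightarrow> real" where "\<forall>a\<in>G. 0 \<le> c a" "(\<Sum>a\<in>G. c a) = r"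
    "(\<Sum>a\<in>G. c a * real (fst a)) \<le> real (fst e)" "(\<Sum>a\<in>G. c a * real (snd a)) \<le> real (snd e)"
    unfolding newton_def by blast
  then show "e + u \<in> newton G r"
    unfolding newton_def by (intro CollectI exI[of _ c]) auto
qed

text \<open>The points \<open>a\<close> and \<open>b\<close> may coincide: \<open>c\<close> adds two
  indicator functions, so their weights then accumulate.\<close>

lemma newton_pair:
  assumes "finite G" "a \<in> G" "b \<in> G" "0 \<le> s" "0 \<le> t"
    and "s * real (fst a) + t * real (fst b) \<le> real (fst e)" "s * real (snd a) + t * real (snd b) \<le> real (snd e)"
  shows "e \<in> newton G (s + t)"
proof -
  define c where "c x = (if x = a then s else 0) + (if x = b then t else 0)" for x
  have "(\<Sum>x\<in>G. c x * g x) = s * g a + t * g b" for g :: "nat \<times> nat \<Rightarrow> real"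
  proof -
    have "(\<Sum>x\<in>G. c x * g x) = (\<Sum>x\<in>G. (if x = a then s * g a else 0) + (if x = b then t * g b else 0))"
      by (rule sum.cong) (auto simp: c_def distrib_right)
    then show ?thesis using assms(1-3) by (simp add: sum.distrib)
  qed
  from this this[of "\<lambda>_. 1"] show ?thesis
    using assms unfolding newton_def by (intro CollectI exI[of _ c]) (auto simp: c_def)
qed

lemma newton_fst:
  assumes "finite G" "e \<in> newton G 1"
  shows "\<exists>a\<in>G. fst a \<le> fst e"
proof (rule ccontr)
  assume neg: "\<not> ?thesis"
  obtain c :: "nat \<times> nat \<Rightarrow> real" where c: "\<forall>a\<in>G. 0 \<le> c a" "(\<Sum>a\<in>G. c a) = 1"
    "(\<Sum>a\<in>G. c a * real (fst a)) \<le> real (fst e)"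
    using assms by (auto simp: newton_def)
  have "real (fst e) + 1 = (\<Sum>a\<in>G. c a * (real (fst e) + 1))"
    using c(2) by (simp flip: sum_distrib_right)
  also have "\<dots> \<le> (\<Sum>a\<in>G. c a * real (fst a))"
    using c(1) neg by (intro sum_mono mult_left_mono) (auto simp: not_le Suc_le_eq[symmetric])
  finally show False using c(3) by simp
qed

lemma newton_snd:
  assumes "finite G" "e \<in> newton G 1"
  shows "\<exists>a\<in>G. snd a \<le> snd e"
proof (rule ccontr)
  assume neg: "\<not> ?thesis"
  obtain c :: "nat \<times> nat \<Rightarrow> real" where c: "\<forall>a\<in>G. 0 \<le> c a" "(\<Sum>a\<in>G. c a) = 1"
    "(\<Sum>a\<in>G. c a * real (snd a)) \<le> real (snd e)"
    using assms by (auto simp: newton_def)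
  have "real (snd e) + 1 = (\<Sum>a\<in>G. c a * (real (snd e) + 1))"
    using c(2) by (simp flip: sum_distrib_right)
  also have "\<dots> \<le> (\<Sum>a\<in>G. c a * real (snd a))"
    using c(1) neg by (intro sum_mono mult_left_mono) (auto simp: not_le Suc_le_eq[symmetric])
  finally show False using c(3) by simp
qed

text \<open>The coefficients of \<open>e + v\<close> sum to \<open>card G + 1\<close>, so one of them is at least \<open>1\<close>.\<close>

lemma newton_reduction:
  assumes G: "finite G" and e: "e \<in> newton G 1" and v: "v \<in> newton G (card G)"
  obtains a u where "a \<in> G" "u \<in> newton G (card G)" "e + v = a + u"
proof -
  obtain c1 :: "nat \<times> nat \<Rightarrow> real" where c1: "\<forall>a\<in>G. 0 \<le> c1 a" "(\<Sum>a\<in>G. c1 a) = 1"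
    "(\<Sum>a\<in>G. c1 a * real (fst a)) \<le> real (fst e)" "(\<Sum>a\<in>G. c1 a * real (snd a)) \<le> real (snd e)"
    using e by (auto simp: newton_def)
  obtain c2 :: "nat \<times> nat \<Rightarrow> real" where c2: "\<forall>a\<in>G. 0 \<le> c2 a" "(\<Sum>a\<in>G. c2 a) = card G"
    "(\<Sum>a\<in>G. c2 a * real (fst a)) \<le> real (fst v)" "(\<Sum>a\<in>G. c2 a * real (snd a)) \<le> real (snd v)"
    using v by (auto simp: newton_def)
  define c where "c a = c1 a + c2 a" for a
  have c: "\<forall>a\<in>G. 0 \<le> c a" "(\<Sum>a\<in>G. c a) = card G + 1"
    "(\<Sum>a\<in>G. c a * real (fst a)) \<le> real (fst (e + v))" "(\<Sum>a\<in>G. c a * real (snd a)) \<le> real (snd (e + v))"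
    using c1 c2 by (auto simp: c_def sum.distrib distrib_right)
  have "\<exists>a\<in>G. 1 \<le> c a"
  proof (rule ccontr)
    assume "\<not> ?thesis"
    then have "(\<Sum>a\<in>G. c a) \<le> real (card G) * 1" by (intro sum_bounded_above) auto
    then show False using c(2) by simp
  qed
  then obtain a where a: "a \<in> G" "1 \<le> c a" by blast
  \<comment> \<open>Taking one unit off \<open>a\<close> brings the total from
    \<open>card G + 1\<close> back to \<open>card G\<close>.\<close>
  define c' where "c' x = c x - (if x = a then 1 else 0)" for x
  have c': "(\<Sum>x\<in>G. c' x * g x) = (\<Sum>x\<in>G. c x * g x) - g a" for g :: "nat \<times> nat \<Rightarrow> real"
  proof -
    have "(\<Sum>x\<in>G. c' x * g x) = (\<Sum>x\<in>G. c x * g x - (if x = a then g a else 0))"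
      by (rule sum.cong) (auto simp: c'_def left_diff_distrib)
    then show ?thesis using G a(1) by (simp add: sum_subtractf)
  qed
  have c'_nonneg: "0 \<le> c' x" if "x \<in> G" for x
    using that a(2) c(1) by (auto simp: c'_def)
  \<comment> \<open>Nonnegativity of what remains shows that \<open>a\<close> lies below
    \<open>e + v\<close>, so the difference \<open>u\<close> is exact.\<close>
  have "0 \<le> (\<Sum>x\<in>G. c' x * real (fst x))" "0 \<le> (\<Sum>x\<in>G. c' x * real (snd x))"
    using c'_nonneg by (auto intro!: sum_nonneg)
  then have "real (fst a) \<le> real (fst (e + v))" "real (snd a) \<le> real (snd (e + v))"
    using c(3,4) c' by auto
  then have le: "fst a \<le> fst (e + v)" "snd a \<le> snd (e + v)" by (simp_all only: of_nat_le_iff)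
  define u where "u = e + v - a"
  have "e + v = a + u" using le by (simp add: u_def prod_eq_iff)
  moreover have "u \<in> newton G (card G)"
    unfolding newton_def
  proof (intro CollectI exI conjI ballI)
    show "0 \<le> c' x" if "x \<in> G" for x by (rule c'_nonneg[OF that])
    show "(\<Sum>x\<in>G. c' x) = card G" using c'[of "\<lambda>_. 1"] c(2) by simp
    show "(\<Sum>x\<in>G. c' x * real (fst x)) \<le> real (fst u)"
      using c'[of "\<lambda>x. real (fst x)"] c(3) le(1) by (simp add: u_def of_nat_diff)
    show "(\<Sum>x\<in>G. c' x * real (snd x)) \<le> real (snd u)"
      using c'[of "\<lambda>x. real (snd x)"] c(4) le(2) by (simp add: u_def of_nat_diff)
  qed
  ultimately show ?thesis using that a(1) by blast
qed

text \<open>A separating line of slope governed by the extreme slopes \<open>\<rho>\<close> and \<open>\<sigma>\<close> at which points of \<open>G\<close>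
  are seen from \<open>e\<close>; \<open>\<rho> * \<sigma> < 1\<close> because no segment between two points of \<open>G\<close> passes below \<open>e\<close>.\<close>

lemma newton_separation:
  assumes G: "finite G" and e: "e \<notin> newton G 1"
  obtains w1 w2 :: real where "0 < w1" "0 < w2"
    "\<And>a. a \<in> G \<Longrightarrow> w1 * real (fst e) + w2 * real (snd e) < w1 * real (fst a) + w2 * real (snd a)"
proof -
  define d1 where "d1 a = real (fst a) - real (fst e)" for a :: "nat \<times> nat"
  define d2 where "d2 a = real (snd a) - real (snd e)" for a :: "nat \<times> nat"
  \<comment> \<open>A nonnegative combination of two displacements from \<open>e\<close> that is
    \<le> 0 in both coordinates would, after normalising \<open>s + t\<close> to 1, put
    \<open>e\<close> into the Newton polygon.\<close>
  have pair: False if "a \<in> G" "b \<in> G" "0 \<le> s" "0 < t" "s * d1 a + t * d1 b \<le> 0" "s * d2 a + t * d2 b \<le> 0" for a b s t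
  proof -
    let ?s = "s / (s + t)" and ?t = "t / (s + t)"
    have st: "0 < s + t" "?s + ?t = 1"
      using that by (simp_all add: add_divide_distrib[symmetric])
    have norm: "?s * x + ?t * y \<le> z" if "s * (x - z) + t * (y - z) \<le> 0" for x y z
    proof -
      have "s * x + t * y \<le> z * (s + t)" using that by (simp add: algebra_simps)
      then have "(s * x + t * y) / (s + t) \<le> z" using st(1) by (simp add: pos_divide_le_eq)
      then show ?thesis by (simp add: add_divide_distrib)
    qed
    have "e \<in> newton G (?s + ?t)"
      using that by (intro newton_pair[OF G, of a b] norm) (auto simp: d1_def d2_def)
    then show False using e st(2) by simp
  qed
  have pos1: "0 < d1 a" if "a \<in> G" "d2 a \<le> 0" for a
  proof (rule ccontr)
    assume "\<not> 0 < d1 a"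
    then show False using pair[of a a 0 1] that by simp
  qed
  have pos2: "0 < d2 a" if "a \<in> G" "d1 a \<le> 0" for a
  proof (rule ccontr)
    assume "\<not> 0 < d2 a"
    then show False using pair[of a a 0 1] that by simp
  qed
  \<comment> \<open>For a point with \<open>d2 a \<le> 0\<close> the quotient measures how steeply
    it lies below \<open>e\<close>; the inserted 0 makes the maximum exist and be
    nonnegative.\<close>
  define R where "R = insert 0 ((\<lambda>a. - d2 a / d1 a) ` {a \<in> G. d2 a \<le> 0})"
  define S where "S = insert 0 ((\<lambda>a. - d1 a / d2 a) ` {a \<in> G. d1 a \<le> 0})"
  define \<rho> where "\<rho> = Max R"
  define \<sigma> where "\<sigma> = Max S"
  have fin: "finite R" "finite S" using G by (auto simp: R_def S_def)
  have zero_in: "0 \<in> R" "0 \<in> S" by (simp_all add: R_def S_def)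
  have nonneg: "0 \<le> \<rho>" "0 \<le> \<sigma>"
    unfolding \<rho>_def \<sigma>_def using Max_ge[OF fin(1) zero_in(1)] Max_ge[OF fin(2) zero_in(2)] .
  have prod: "\<rho> * \<sigma> < 1"
  proof -
    have "\<rho> \<in> R" "\<sigma> \<in> S"
      unfolding \<rho>_def \<sigma>_def using Max_in[OF fin(1)] Max_in[OF fin(2)] zero_in by blast+
    then consider "\<rho> = 0" | "\<sigma> = 0"
      | a b where "a \<in> G" "d2 a \<le> 0" "\<rho> = - d2 a / d1 a" "b \<in> G" "d1 b \<le> 0" "\<sigma> = - d1 b / d2 b"
      unfolding R_def S_def by blast
    then show ?thesis
    proof cases
      case 3
      have pos: "0 < d1 a" "0 < d2 b" using 3 pos1 pos2 by auto
      have "d2 a * d1 b < d1 a * d2 b"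
      proof (rule ccontr)
        assume "\<not> ?thesis"
        \<comment> \<open>These coefficients cancel the first coordinates exactly and leave the
          second ones to decide.\<close>
        then have "(- d1 b) * d2 a + d1 a * d2 b \<le> 0" by (simp add: mult.commute)
        moreover have "(- d1 b) * d1 a + d1 a * d1 b \<le> 0" by simp
        ultimately show False using pair[of a b "- d1 b" "d1 a"] 3 pos by simp
      qed
      moreover have "\<rho> * \<sigma> = (d2 a * d1 b) / (d1 a * d2 b)" using 3 by simp
      ultimately show ?thesis using pos by simp
    qed auto
  qed
  \<comment> \<open>If \<open>d2 a \<le> 0\<close>, then \<open>- d2 a \<le> \<rho> * d1 a\<close>
    bounds the form from below by \<open>(1 - \<rho> * \<sigma>) * d1 a > 0\<close>, and
    symmetrically if \<open>d1 a \<le> 0\<close>. The summand 1 keeps both weights strictly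
    positive.\<close>
  have "0 < (1 + \<rho>) * d1 a + (1 + \<sigma>) * d2 a" if a: "a \<in> G" for a
  proof -
    consider "d2 a \<le> 0" | "d1 a \<le> 0" | "0 < d1 a" "0 < d2 a" by linarith
    then show ?thesis
    proof cases
      case 1
      then have "- d2 a / d1 a \<in> R" unfolding R_def using a by blast
      then have "- d2 a / d1 a \<le> \<rho>" unfolding \<rho>_def by (rule Max_ge[OF fin(1)])
      then have "- d2 a \<le> \<rho> * d1 a" by (simp only: pos_divide_le_eq[OF pos1[OF a 1]])
      then have "(1 + \<sigma>) * (- d2 a) \<le> (1 + \<sigma>) * (\<rho> * d1 a)" using nonneg by (intro mult_left_mono) auto
      moreover have "0 < (1 - \<rho> * \<sigma>) * d1 a" using prod pos1[OF a 1] by simp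
      ultimately show ?thesis by (simp add: algebra_simps)
    next
      case 2
      then have "- d1 a / d2 a \<in> S" unfolding S_def using a by blast
      then have "- d1 a / d2 a \<le> \<sigma>" unfolding \<sigma>_def by (rule Max_ge[OF fin(2)])
      then have "- d1 a \<le> \<sigma> * d2 a" by (simp only: pos_divide_le_eq[OF pos2[OF a 2]])
      then have "(1 + \<rho>) * (- d1 a) \<le> (1 + \<rho>) * (\<sigma> * d2 a)" using nonneg by (intro mult_left_mono) auto
      moreover have "0 < (1 - \<rho> * \<sigma>) * d2 a" using prod pos2[OF a 2] by simp
      ultimately show ?thesis by (simp add: algebra_simps)
    next
      case 3
      moreover have "0 < 1 + \<rho>" "0 < 1 + \<sigma>" using nonneg by simp_all
      ultimately show ?thesis by (simp add: add_pos_pos)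
    qed
  qed
  then have "(1 + \<rho>) * real (fst e) + (1 + \<sigma>) * real (snd e)
    < (1 + \<rho>) * real (fst a) + (1 + \<sigma>) * real (snd a)" if "a \<in> G" for a
    using that by (simp add: d1_def d2_def algebra_simps)
  then show ?thesis using that[of "1 + \<rho>" "1 + \<sigma>"] nonneg by simp
qed

section \<open>Integral elements have support in the Newton polygon\<close>

lemma is_ideal_ideal_power: "is_ideal (ideal_power I k)"
  by (cases k) (auto simp: is_ideal_span module.subspace_UNIV[OF module_mult])

context
  fixes w1 w2 :: real
  assumes w: "0 < w1" "0 < w2"
begin

definition weight :: "nat \<times> nat \<Rightarrow> real" where
  "weight u = w1 * real (fst u) + w2 * real (snd u)"

lemma weight_add: "weight (u + v) = weight u + weight v"
  by (simp add: weight_def algebra_simps)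

lemma weight_nonneg: "0 \<le> weight u"
  using w by (simp add: weight_def)

definition weight_ideal :: "real \<Rightarrow> 'k::field poly2 set" where
  "weight_ideal r = mon_ideal {u. r \<le> weight u}"

lemma is_ideal_weight_ideal: "is_ideal (weight_ideal r)"
  unfolding weight_ideal_def
  by (rule mon_ideal_is_ideal)
    (auto simp only: up_closed_def weight_add mem_Collect_eq intro: add_increasing2 weight_nonneg)

lemma weight_ideal_mult:
  assumes "g \<in> weight_ideal r" "h \<in> weight_ideal s"
  shows "g * h \<in> weight_ideal (r + s)"
  unfolding weight_ideal_def mon_ideal_def
proof (intro CollectI subsetI)
  fix u assume "u \<in> Poly_Mapping.keys (g * h)"
  then obtain a b where "u = a + b" "a \<in> Poly_Mapping.keys g" "b \<in> Poly_Mapping.keys h"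
    using keys_mult[of g h] by blast
  then show "r + s \<le> weight u"
    using assms unfolding weight_ideal_def mon_ideal_def by (auto simp: weight_add intro: add_mono)
qed

lemma weight_ideal_power:
  assumes "g \<in> weight_ideal r"
  shows "g ^ m \<in> weight_ideal (real m * r)"
proof (induction m)
  case 0
  show ?case by (simp add: weight_ideal_def mon_ideal_def weight_def)
next
  case (Suc m)
  then show ?case using weight_ideal_mult[OF assms Suc] by (simp add: algebra_simps)
qed

lemma ideal_power_subset_weight_ideal:
  assumes "I \<subseteq> weight_ideal r"
  shows "ideal_power I k \<subseteq> weight_ideal (real k * r)"
proof (induction k)
  case 0
  show ?case by (auto simp: weight_ideal_def mon_ideal_def weight_nonneg)
next
  case (Suc k)
  show ?case
    unfolding ideal_power.simps
  proof (rule ideal_span_minimal)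
    show "{f * g | f g. f \<in> I \<and> g \<in> ideal_power I k} \<subseteq> weight_ideal (real (Suc k) * r)"
    proof clarify
      fix f g assume "f \<in> I" "g \<in> ideal_power I k"
      then show "f * g \<in> weight_ideal (real (Suc k) * r)"
        using weight_ideal_mult[of f r g "real k * r"] assms Suc by (auto simp: algebra_simps)
    qed
  qed (rule is_ideal_weight_ideal)
qed

text \<open>Ties in weight are broken by the first coordinate; as \<open>w2 > 0\<close>, weight and
  first coordinate determine the exponent, so a nonzero polynomial has a single initial term. Both
  criteria are additive, which makes initial terms multiplicative.\<close>

definition precedes :: "nat \<times> nat \<Rightarrow> nat \<times> nat \<Rightarrow> bool" where
  "precedes a b \<longleftrightarrow> weight a < weight b \<or> (weight a = weight b \<and> fst a < fst b)"

lemma precedes_add: "precedes a b \<Longrightarrow> precedes (c + a) (c + b)"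
  by (auto simp: precedes_def weight_add)

lemma precedes_trans: "precedes a b \<Longrightarrow> precedes b c \<Longrightarrow> precedes a c"
  by (auto simp: precedes_def)

lemma precedes_irrefl: "\<not> precedes a a"
  by (simp add: precedes_def)

lemma initial_exponent_exists:
  assumes "f \<noteq> 0"
  obtains e where "e \<in> Poly_Mapping.keys f" "\<And>u. u \<in> Poly_Mapping.keys f \<Longrightarrow> u \<noteq> e \<Longrightarrow> precedes e u"
proof -
  let ?K = "Poly_Mapping.keys f"
  define \<mu> where "\<mu> = Min (weight ` ?K)"
  have "\<mu> \<in> weight ` ?K" unfolding \<mu>_def using assms by (intro Min_in) auto
  then obtain e1 where "e1 \<in> ?K" "weight e1 = \<mu>" by auto
  then obtain e where e: "e \<in> ?K" "weight e = \<mu>" "\<And>u. u \<in> ?K \<Longrightarrow> weight u = \<mu> \<Longrightarrow> fst e \<le> fst u"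
    using ex_has_least_nat[of "\<lambda>u. u \<in> ?K \<and> weight u = \<mu>" e1 fst] by blast
  have "precedes e u" if "u \<in> ?K" "u \<noteq> e" for u
  proof -
    have "\<mu> \<le> weight u" unfolding \<mu>_def using that by (intro Min_le) auto
    moreover have "fst e \<noteq> fst u" if weight_u: "weight u = \<mu>"
    proof
      assume "fst e = fst u"
      then have "w2 * real (snd u) = w2 * real (snd e)" 
        using weight_u e(2) unfolding weight_def \<open>fst e = fst u\<close> by linarith
      then have "snd u = snd e" using w by simp
      then show False using \<open>fst e = fst u\<close> \<open>u \<noteq> e\<close> by (simp add: prod_eq_iff)
    qed
    ultimately show ?thesis using e(2) e(3)[OF that(1)] unfolding precedes_def by linarith
  qed
  then show ?thesis using that e(1) by blast
qed

text \<open>Every other product of terms comes strictly later, because the order is compatible with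
  addition, so nothing can cancel the product of the initial terms.\<close>

lemma initial_term_mult:
  assumes p: "p = Poly_Mapping.single a c + g" "\<And>u. u \<in> Poly_Mapping.keys g \<Longrightarrow> precedes a u"
    and q: "q = Poly_Mapping.single b d + h" "\<And>u. u \<in> Poly_Mapping.keys h \<Longrightarrow> precedes b u"
  obtains r where "p * q = Poly_Mapping.single (a + b) (c * d) + r"
    "\<And>u. u \<in> Poly_Mapping.keys r \<Longrightarrow> precedes (a + b) u"
proof
  let ?s = "Poly_Mapping.single a c * h" and ?t = "g * q"
  have "p * q = Poly_Mapping.single a c * q + g * q" unfolding p(1) by (rule distrib_right)
  also have "Poly_Mapping.single a c * q = Poly_Mapping.single (a + b) (c * d) + ?s"
    unfolding q(1) distrib_left mult_single ..
  finally show "p * q = Poly_Mapping.single (a + b) (c * d) + (?s + ?t)" by (simp only: add.assoc)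
  fix u assume "u \<in> Poly_Mapping.keys (?s + ?t)"
  then consider "u \<in> Poly_Mapping.keys ?s" | "u \<in> Poly_Mapping.keys ?t" using keys_add[of ?s ?t] by blast
  then show "precedes (a + b) u"
  proof cases
    case 1
    then obtain x y where "u = x + y" "x \<in> Poly_Mapping.keys (Poly_Mapping.single a c)" "y \<in> Poly_Mapping.keys h"
      using keys_mult[of "Poly_Mapping.single a c" h] by blast
    moreover from this(2) have "x = a" by (simp split: if_splits)
    ultimately show ?thesis using precedes_add[OF q(2), of y a] by simp
  next
    case 2
    then obtain x y where u: "u = x + y" "x \<in> Poly_Mapping.keys g" "y \<in> Poly_Mapping.keys q"
      using keys_mult[of g q] by blast
    from u(3) have "y \<in> Poly_Mapping.keys (Poly_Mapping.single b d + h)" unfolding q(1) .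
    then have "y \<in> Poly_Mapping.keys (Poly_Mapping.single b d) \<or> y \<in> Poly_Mapping.keys h"
      using keys_add[of "Poly_Mapping.single b d" h] by blast
    then have "y = b \<or> precedes b y"
    proof
      assume "y \<in> Poly_Mapping.keys h"
      then show ?thesis using q(2) by simp
    qed (simp split: if_splits)
    moreover have "precedes (a + b) (x + b)"
      using precedes_add[OF p(2)[OF u(2)], of b] by (simp only: add.commute)
    ultimately show ?thesis unfolding u(1) by (auto intro: precedes_trans[OF _ precedes_add])
  qed
qed

lemma initial_term_power:
  assumes "f = Poly_Mapping.single e c + g" "\<And>u. u \<in> Poly_Mapping.keys g \<Longrightarrow> precedes e u"
  shows "\<exists>h. f ^ m = Poly_Mapping.single (m * fst e, m * snd e) (c ^ m) + h \<and>
    (\<forall>u\<in>Poly_Mapping.keys h. precedes (m * fst e, m * snd e) u)"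
proof (induction m)
  case 0
  show ?case by (rule exI[of _ 0]) (simp flip: zero_prod_def)
next
  case (Suc m)
  then obtain h where h: "f ^ m = Poly_Mapping.single (m * fst e, m * snd e) (c ^ m) + h"
    "\<And>u. u \<in> Poly_Mapping.keys h \<Longrightarrow> precedes (m * fst e, m * snd e) u" by blast
  obtain r where r: "f * f ^ m = Poly_Mapping.single (e + (m * fst e, m * snd e)) (c * c ^ m) + r"
    "\<And>u. u \<in> Poly_Mapping.keys r \<Longrightarrow> precedes (e + (m * fst e, m * snd e)) u"
    by (rule initial_term_mult[OF assms h]) blast+
  have eq: "e + (m * fst e, m * snd e) = (Suc m * fst e, Suc m * snd e)" by (simp add: prod_eq_iff)
  show ?case using r unfolding eq power_Suc by blast
qed

text \<open>Let \<mu> be the least weight in \<open>f\<close>. If \<mu> < r, the initial term of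
  \<open>f ^ n\<close> has weight n \<mu> exactly, while the k-th term of the integral equation has
  weight at least k r + (n - k) \<mu>, which is larger by at least r - \<mu> because k \<ge>
  1.\<close>

lemma integral_weight_bound:
  fixes f :: "'k::field poly2"
  assumes I: "I \<subseteq> weight_ideal r" and f: "f \<in> ideal_integral_closure I" and e: "e \<in> Poly_Mapping.keys f"
  shows "r \<le> weight e"
proof (rule ccontr)
  assume neg: "\<not> r \<le> weight e"
  obtain n a where na: "0 < n" "\<And>k. k \<in> {1..n} \<Longrightarrow> a k \<in> ideal_power I k"
    "f ^ n + (\<Sum>k = 1..n. a k * f ^ (n - k)) = 0"
    using f unfolding ideal_integral_closure_def by blast
  have "f \<noteq> 0" using e by auto
  then obtain e0 where e0: "e0 \<in> Poly_Mapping.keys f" "\<And>u. u \<in> Poly_Mapping.keys f \<Longrightarrow> u \<noteq> e0 \<Longrightarrow> precedes e0 u"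
    by (rule initial_exponent_exists) blast
  define \<mu> where "\<mu> = weight e0"
  have min: "\<mu> \<le> weight u" if "u \<in> Poly_Mapping.keys f" for u
    using e0(2)[OF that] by (cases "u = e0") (auto simp: \<mu>_def precedes_def)
  have \<mu>: "\<mu> < r" using min[OF e] neg by simp
  have f_in: "f \<in> weight_ideal \<mu>" using min by (auto simp: weight_ideal_def mon_ideal_def)
  define c where "c = Poly_Mapping.lookup f e0"
  define g where "g = f - Poly_Mapping.single e0 c"
  have c: "c \<noteq> 0" using e0(1) by (simp add: c_def in_keys_iff)
  have "precedes e0 u" if "u \<in> Poly_Mapping.keys g" for u
  proof (rule e0(2))
    show "u \<noteq> e0" using that by (auto simp: g_def in_keys_iff lookup_minus c_def)
    then show "u \<in> Poly_Mapping.keys f" using that by (simp add: g_def in_keys_iff lookup_minus lookup_single)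
  qed
  moreover have "f = Poly_Mapping.single e0 c + g" by (simp add: g_def)
  ultimately obtain h where h: "f ^ n = Poly_Mapping.single (n * fst e0, n * snd e0) (c ^ n) + h"
    "\<And>u. u \<in> Poly_Mapping.keys h \<Longrightarrow> precedes (n * fst e0, n * snd e0) u"
    using initial_term_power[of f e0 c g n] by blast
  let ?u = "(n * fst e0, n * snd e0)"
  have "?u \<notin> Poly_Mapping.keys h" using h(2) precedes_irrefl by blast
  then have "Poly_Mapping.lookup (f ^ n) ?u = c ^ n"
    by (simp add: h(1) lookup_add in_keys_iff)
  then have key: "?u \<in> Poly_Mapping.keys (f ^ n)" using c by (simp add: in_keys_iff)
  have "(\<Sum>k = 1..n. a k * f ^ (n - k)) \<in> weight_ideal (real n * \<mu> + (r - \<mu>))"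
  proof (rule is_ideal_sum[OF is_ideal_weight_ideal])
    fix k assume k: "k \<in> {1..n}"
    have "a k \<in> weight_ideal (real k * r)"
      using ideal_power_subset_weight_ideal[OF I] na(2)[OF k] by blast
    from weight_ideal_mult[OF this weight_ideal_power[OF f_in]]
    have "a k * f ^ (n - k) \<in> weight_ideal (real k * r + real (n - k) * \<mu>)" .
    moreover have "real n * \<mu> + (r - \<mu>) \<le> real k * r + real (n - k) * \<mu>"
    proof -
      have "1 * (r - \<mu>) \<le> real k * (r - \<mu>)" using k \<mu> by (intro mult_right_mono) auto
      then show ?thesis using k by (simp add: of_nat_diff algebra_simps)
    qed
    ultimately show "a k * f ^ (n - k) \<in> weight_ideal (real n * \<mu> + (r - \<mu>))"
      by (force simp: weight_ideal_def mon_ideal_def)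
  qed
  moreover have "f ^ n = - (\<Sum>k = 1..n. a k * f ^ (n - k))"
    using na(3) by (simp add: eq_neg_iff_add_eq_0)
  ultimately have "f ^ n \<in> weight_ideal (real n * \<mu> + (r - \<mu>))"
    by (simp add: weight_ideal_def mon_ideal_def in_keys_iff subset_iff)
  with key have "real n * \<mu> + (r - \<mu>) \<le> weight ?u"
    by (auto simp: weight_ideal_def mon_ideal_def)
  also have "weight ?u = real n * \<mu>" by (simp add: weight_def \<mu>_def algebra_simps)
  finally show False using \<mu> by simp
qed

end

lemma integral_closure_subset_newton:
  fixes f :: "'k::field poly2"
  assumes G: "finite G" and ne: "G \<noteq> {}" and A: "A = {e. \<exists>p\<in>G. fst p \<le> fst e \<and> snd p \<le> snd e}"
    and f: "f \<in> ideal_integral_closure (mon_ideal A)"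
  shows "f \<in> mon_ideal (newton G 1)"
  unfolding mon_ideal_def
proof (intro CollectI subsetI, rule ccontr)
  fix e assume e: "e \<in> Poly_Mapping.keys f" "e \<notin> newton G 1"
  obtain w1 w2 :: real where w: "0 < w1" "0 < w2"
    "\<And>a. a \<in> G \<Longrightarrow> w1 * real (fst e) + w2 * real (snd e) < w1 * real (fst a) + w2 * real (snd a)"
    using newton_separation[OF G e(2)] by blast
  let ?w = "weight w1 w2"
  \<comment> \<open>Positive weights are monotone, so their minimum over \<open>G\<close> bounds
    them on all of \<open>A\<close>; \<open>e\<close> is strictly lighter than this minimum.\<close>
  define r where "r = Min (?w ` G)"
  have "mon_ideal A \<subseteq> (weight_ideal w1 w2 r :: 'k poly2 set)"
  proof -
    have "r \<le> ?w u" if u: "u \<in> A" for u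
    proof -
      obtain p where p: "p \<in> G" "fst p \<le> fst u" "snd p \<le> snd u" using u A by blast
      have "r \<le> ?w p" unfolding r_def using G p by (intro Min_le) auto
      also have "\<dots> \<le> ?w u"
        using w(1,2) p by (auto simp: weight_def[OF w(1,2)] intro!: add_mono)
      finally show ?thesis .
    qed
    then show ?thesis unfolding weight_ideal_def[OF w(1,2)] mon_ideal_def by blast
  qed
  from integral_weight_bound[OF w(1,2) this f e(1)] have "r \<le> ?w e" .
  moreover have "r \<in> ?w ` G" unfolding r_def using G ne by (intro Min_in) auto
  ultimately show False using w(3) by (fastforce simp: weight_def[OF w(1,2)])
qed

section \<open>Polynomials with support in the Newton polygon are integral\<close>

lemma ideal_power_mult:
  assumes "p \<in> ideal_power I k" "q \<in> ideal_power I l"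
  shows "p * q \<in> ideal_power I (k + l)"
  using assms
proof (induction k arbitrary: p)
  case 0
  then show ?case using is_ideal_ideal_power[of I l] by (simp add: is_ideal_def)
next
  case (Suc k)
  let ?S = "{f * g | f g. f \<in> I \<and> g \<in> ideal_power I k}"
  let ?T = "{p. p * q \<in> ideal_power I (Suc k + l)}"
  have "is_ideal ?T"
    using is_ideal_ideal_power[of I "Suc k + l"] by (auto simp: is_ideal_def distrib_right mult.assoc)
  moreover have "?S \<subseteq> ?T"
  proof clarify
    fix f g assume "f \<in> I" "g \<in> ideal_power I k"
    then have "g * q \<in> ideal_power I (k + l)" using Suc by blast
    then have "f * (g * q) \<in> ideal_power I (Suc (k + l))"
      using \<open>f \<in> I\<close> unfolding ideal_power.simps by (intro ideal_span_base) blast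
    then show "f * g * q \<in> ideal_power I (Suc k + l)" by (simp add: mult.assoc)
  qed
  ultimately have "module.span (*) ?S \<subseteq> ?T" by (intro ideal_span_minimal)
  then show ?case using Suc.prems by auto
qed

text \<open>The sum of the ideals I^k f^(d-k) with k \<ge> 1: \<open>f ^ d\<close> lies in it
  precisely when \<open>f\<close> satisfies an integral equation of degree d. As a span it is easy
  to multiply; coefficients are recovered in \<open>lower_terms_explicit\<close>.\<close>

definition lower_terms :: "'k::field poly2 set \<Rightarrow> 'k poly2 \<Rightarrow> nat \<Rightarrow> 'k poly2 set" where
  "lower_terms I f d = module.span (*) {a * f ^ (d - k) | a k. k \<in> {1..d} \<and> a \<in> ideal_power I k}"

lemma is_ideal_lower_terms: "is_ideal (lower_terms I f d)"
  by (simp add: lower_terms_def is_ideal_span)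

lemma lower_terms_base: "1 \<le> k \<Longrightarrow> k \<le> d \<Longrightarrow> a \<in> ideal_power I k \<Longrightarrow> a * f ^ (d - k) \<in> lower_terms I f d"
  unfolding lower_terms_def by (intro ideal_span_base) auto

lemma is_ideal_vimage_mult: "is_ideal J \<Longrightarrow> is_ideal {p. q * p \<in> J}"
  for J :: "'a::comm_ring_1 set"
  by (auto simp: is_ideal_def distrib_left mult.left_commute)

lemma lower_terms_power_mult:
  assumes "g \<in> lower_terms I f d"
  shows "f ^ c * g \<in> lower_terms I f (c + d)"
proof -
  have "lower_terms I f d \<subseteq> {g. f ^ c * g \<in> lower_terms I f (c + d)}"
    unfolding lower_terms_def[of I f d]
  proof (rule ideal_span_minimal)
    show "{a * f ^ (d - k) | a k. k \<in> {1..d} \<and> a \<in> ideal_power I k} \<subseteq> {g. f ^ c * g \<in> lower_terms I f (c + d)}"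
    proof clarify
      fix a k assume k: "k \<in> {1..d}" "a \<in> ideal_power I k"
      have "f ^ c * (a * f ^ (d - k)) = a * f ^ (c + d - k)"
        using k by (simp add: power_add[symmetric] mult.left_commute)
      then show "f ^ c * (a * f ^ (d - k)) \<in> lower_terms I f (c + d)"
        using lower_terms_base[of k "c + d" a] k by simp
    qed
  qed (intro is_ideal_vimage_mult is_ideal_lower_terms)
  then show ?thesis using assms by blast
qed

text \<open>Degrees add: I^k f^(c-k) times I^l f^(d-l) lies in I^(k+l) f^(c+d-k-l). The two factors
  are reduced to generators one at a time.\<close>

lemma lower_terms_mult:
  assumes g: "g \<in> lower_terms I f c" and h: "h \<in> lower_terms I f d"
  shows "g * h \<in> lower_terms I f (c + d)"
proof -
  have *: "a * f ^ (c - k) * h \<in> lower_terms I f (c + d)" if k: "k \<in> {1..c}" "a \<in> ideal_power I k" for a k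
  proof -
    have "lower_terms I f d \<subseteq> {h. a * f ^ (c - k) * h \<in> lower_terms I f (c + d)}"
      unfolding lower_terms_def[of I f d]
    proof (rule ideal_span_minimal)
      show "{b * f ^ (d - l) | b l. l \<in> {1..d} \<and> b \<in> ideal_power I l}
        \<subseteq> {h. a * f ^ (c - k) * h \<in> lower_terms I f (c + d)}"
      proof clarify
        fix b l assume l: "l \<in> {1..d}" "b \<in> ideal_power I l"
        have "a * f ^ (c - k) * (b * f ^ (d - l)) = a * b * (f ^ (c - k) * f ^ (d - l))"
          by (simp add: mult_ac)
        also have "\<dots> = a * b * f ^ (c + d - (k + l))"
          using k l by (simp flip: power_add)
        finally show "a * f ^ (c - k) * (b * f ^ (d - l)) \<in> lower_terms I f (c + d)"
          using lower_terms_base[of "k + l" "c + d" "a * b"] k l ideal_power_mult[OF k(2) l(2)] by simp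
      qed
    qed (intro is_ideal_vimage_mult is_ideal_lower_terms)
    then show ?thesis using h by blast
  qed
  have "lower_terms I f c \<subseteq> {g. h * g \<in> lower_terms I f (c + d)}"
    unfolding lower_terms_def[of I f c]
  proof (rule ideal_span_minimal)
    show "{a * f ^ (c - k) | a k. k \<in> {1..c} \<and> a \<in> ideal_power I k} \<subseteq> {g. h * g \<in> lower_terms I f (c + d)}"
      using * unfolding mult.commute[of h] by blast
  qed (intro is_ideal_vimage_mult is_ideal_lower_terms)
  then show ?thesis using g by (auto simp: mult.commute)
qed

text \<open>For fixed k the coefficients from the ideal I^k collect into one, so the sums with one
  coefficient per k already form an ideal.\<close>

lemma lower_terms_explicit:
  assumes "g \<in> lower_terms I f d"
  obtains a where "\<And>k. k \<in> {1..d} \<Longrightarrow> a k \<in> ideal_power I k" "g = (\<Sum>k = 1..d. a k * f ^ (d - k))"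
proof -
  let ?T = "{\<Sum>k = 1..d. a k * f ^ (d - k) | a. \<forall>k\<in>{1..d}. a k \<in> ideal_power I k}"
  have "lower_terms I f d \<subseteq> ?T"
    unfolding lower_terms_def
  proof (rule ideal_span_minimal)
    show "is_ideal ?T"
      unfolding is_ideal_def
    proof (intro conjI ballI allI)
      show "0 \<in> ?T"
        using is_ideal_ideal_power[of I] by (auto simp: is_ideal_def intro!: exI[of _ "\<lambda>_. 0"])
      fix p assume "p \<in> ?T"
      then obtain a where a: "p = (\<Sum>k = 1..d. a k * f ^ (d - k))" "\<forall>k\<in>{1..d}. a k \<in> ideal_power I k" by blast
      have 1: "c * p = (\<Sum>k = 1..d. (c * a k) * f ^ (d - k))" for c by (simp add: a(1) sum_distrib_left mult.assoc)
      have 2: "\<forall>k\<in>{1..d}. c * a k \<in> ideal_power I k" for c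
        using a(2) is_ideal_ideal_power[of I] by (auto simp: is_ideal_def)
      show "c * p \<in> ?T" for c using 1[of c] 2[of c] by (intro CollectI exI[of _ "\<lambda>k. c * a k"]) simp
      fix q assume "q \<in> ?T"
      then obtain b where b: "q = (\<Sum>k = 1..d. b k * f ^ (d - k))" "\<forall>k\<in>{1..d}. b k \<in> ideal_power I k" by blast
      have "p + q = (\<Sum>k = 1..d. (a k + b k) * f ^ (d - k))" by (simp add: a(1) b(1) sum.distrib distrib_right)
      moreover have "\<forall>k\<in>{1..d}. a k + b k \<in> ideal_power I k"
        using a(2) b(2) is_ideal_ideal_power[of I] by (auto simp: is_ideal_def)
      ultimately show "p + q \<in> ?T" by (intro CollectI exI[of _ "\<lambda>k. a k + b k"]) simp
    qed
    show "{a * f ^ (d - k) | a k. k \<in> {1..d} \<and> a \<in> ideal_power I k} \<subseteq> ?T"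
    proof clarify
      fix a k assume k: "k \<in> {1..d}" "a \<in> ideal_power I k"
      define b where "b i = (if i = k then a else 0)" for i
      have "(\<Sum>i = 1..d. b i * f ^ (d - i)) = (\<Sum>i = 1..d. if i = k then a * f ^ (d - k) else 0)"
        by (rule sum.cong) (auto simp: b_def)
      then have "a * f ^ (d - k) = (\<Sum>i = 1..d. b i * f ^ (d - i))" using k by simp
      moreover have "\<forall>i\<in>{1..d}. b i \<in> ideal_power I i"
        using k is_ideal_ideal_power[of I] by (auto simp: b_def is_ideal_def)
      ultimately show "\<exists>b. a * f ^ (d - k) = (\<Sum>i = 1..d. b i * f ^ (d - i)) \<and> (\<forall>i\<in>{1..d}. b i \<in> ideal_power I i)"
        by blast
    qed
  qed
  then show ?thesis using assms that by blast
qed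

lemma integral_of_power_in_lower_terms:
  assumes "f ^ d \<in> lower_terms I f d"
  shows "f \<in> ideal_integral_closure I"
proof -
  obtain a where a: "\<And>k. k \<in> {1..d} \<Longrightarrow> a k \<in> ideal_power I k" "f ^ d = (\<Sum>k = 1..d. a k * f ^ (d - k))"
    using assms by (rule lower_terms_explicit) blast
  \<comment> \<open>For d = 0 the sum is empty and the equation would read 1 = 0.\<close>
  have "0 < d" using a(2) by (cases d) auto
  moreover have "- a k \<in> ideal_power I k" if "k \<in> {1..d}" for k
    using a(1)[OF that] module.subspace_neg[OF module_mult is_ideal_ideal_power] by blast
  moreover have "f ^ d + (\<Sum>k = 1..d. - a k * f ^ (d - k)) = 0"
    using a(2) by (simp add: sum_negf)
  ultimately show ?thesis unfolding ideal_integral_closure_def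
    by (intro CollectI exI[of _ d] exI[of _ "\<lambda>k. - a k"]) simp
qed

text \<open>Fraction-free Gaussian elimination in place of the determinant trick: after eliminating the last
  unknown, the diagonal is again \<open>f\<close> to some power plus lower terms and the other entries are lower
  terms, with \<open>d\<close> doubled.\<close>

lemma elimination:
  assumes "\<And>i. i < Suc n \<Longrightarrow> (\<Sum>j<Suc n. D i j * v j) = 0"
    and "\<And>i. i < Suc n \<Longrightarrow> D i i - f ^ d \<in> lower_terms I f d"
    and "\<And>i j. i < Suc n \<Longrightarrow> j < Suc n \<Longrightarrow> i \<noteq> j \<Longrightarrow> D i j \<in> lower_terms I f d"
  shows "\<exists>c E. E - f ^ c \<in> lower_terms I f c \<and> E * v 0 = 0"
  using assms
proof (induction n arbitrary: d D)
  case 0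
  then show ?case by (intro exI[of _ d] exI[of _ "D 0 0"]) auto
next
  case (Suc n)
  let ?m = "Suc n"
  let ?L = "lower_terms I f d" and ?L2 = "lower_terms I f (d + d)"
  have L2_add: "p + q \<in> ?L2" if "p \<in> ?L2" "q \<in> ?L2" for p q
    using that is_ideal_lower_terms[of I f "d + d"] by (auto simp: is_ideal_def)
  have L2_diff: "p - q \<in> ?L2" if "p \<in> ?L2" "q \<in> ?L2" for p q
    using that by (rule is_ideal_diff[OF is_ideal_lower_terms])
  define p where "p = D ?m ?m"
  \<comment> \<open>Row \<open>i\<close> times the pivot minus \<open>D i ?m\<close> times the last
    row: the coefficient of the last unknown cancels.\<close>
  define D' where "D' i j = p * D i j - D i ?m * D ?m j" for i j
  have p: "p - f ^ d \<in> ?L" using Suc.prems(2)[of ?m] by (simp add: p_def)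
  show ?case
  proof (rule Suc.IH[of D' "d + d"])
    fix i assume i: "i < Suc n"
    have 1: "(\<Sum>j<Suc n. D i j * v j) = - (D i ?m * v ?m)"
      using Suc.prems(1)[of i] i by (simp add: eq_neg_iff_add_eq_0 add.assoc)
    have 2: "(\<Sum>j<Suc n. D ?m j * v j) = - (p * v ?m)"
      using Suc.prems(1)[of ?m] by (simp add: eq_neg_iff_add_eq_0 p_def add.assoc)
    have "(\<Sum>j<Suc n. D' i j * v j) = p * (\<Sum>j<Suc n. D i j * v j) - D i ?m * (\<Sum>j<Suc n. D ?m j * v j)"
      by (simp only: D'_def left_diff_distrib sum_subtractf sum_distrib_left mult.assoc)
    then show "(\<Sum>j<Suc n. D' i j * v j) = 0" unfolding 1 2 by (simp add: mult_ac)
    have ii: "D i i - f ^ d \<in> ?L" using Suc.prems(2)[of i] i by simp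
    have off: "D i ?m \<in> ?L" "D ?m j \<in> ?L" if "j < Suc n" for j
      using Suc.prems(3)[of i ?m] Suc.prems(3)[of ?m j] i that by auto
    \<comment> \<open>Writing both diagonal entries as \<open>f ^ d\<close> plus a lower term leaves
      only products of lower terms with each other or with \<open>f ^ d\<close>.\<close>
    have "D' i i - f ^ (d + d) = (p - f ^ d) * (D i i - f ^ d) + f ^ d * (D i i - f ^ d)
      + f ^ d * (p - f ^ d) - D i ?m * D ?m i"
      by (simp add: D'_def power_add algebra_simps)
    also have "\<dots> \<in> ?L2"
      using off i by (intro L2_diff L2_add lower_terms_mult lower_terms_power_mult p ii) auto
    finally show "D' i i - f ^ (d + d) \<in> ?L2" .
    fix j assume j: "j < Suc n" "i \<noteq> j"
    have ij: "D i j \<in> ?L" using Suc.prems(3)[of i j] i j by simp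
    have "D' i j = (p - f ^ d) * D i j + f ^ d * D i j - D i ?m * D ?m j"
      by (simp add: D'_def algebra_simps)
    also have "\<dots> \<in> ?L2"
      using off j by (intro L2_diff L2_add lower_terms_mult lower_terms_power_mult p ij) auto
    finally show "D' i j \<in> ?L2" .
  qed
qed

section \<open>Multiplication by \<open>f\<close> on the ideal of the dilated Newton polygon\<close>

lemma is_ideal_combinations:
  assumes "is_ideal J"
  shows "is_ideal {\<Sum>k<n. b k * v k | b. \<forall>k<n. b k \<in> J}" (is "is_ideal ?K")
  unfolding is_ideal_def
proof (intro conjI ballI allI)
  show "0 \<in> ?K" using assms by (auto simp: is_ideal_def intro!: exI[of _ "\<lambda>_. 0"])
  fix p assume "p \<in> ?K"
  then obtain a where a: "p = (\<Sum>k<n. a k * v k)" "\<forall>k<n. a k \<in> J" by blast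
  have 1: "c * p = (\<Sum>k<n. (c * a k) * v k)" for c by (simp add: a(1) sum_distrib_left mult.assoc)
  have 2: "\<forall>k<n. c * a k \<in> J" for c using a(2) assms by (auto simp: is_ideal_def)
  show "c * p \<in> ?K" for c using 1[of c] 2[of c] by (intro CollectI exI[of _ "\<lambda>k. c * a k"]) simp
  fix q assume "q \<in> ?K"
  then obtain b where b: "q = (\<Sum>k<n. b k * v k)" "\<forall>k<n. b k \<in> J" by blast
  have "p + q = (\<Sum>k<n. (a k + b k) * v k)" by (simp add: a(1) b(1) sum.distrib distrib_right)
  moreover have "\<forall>k<n. a k + b k \<in> J" using a(2) b(2) assms by (auto simp: is_ideal_def)
  ultimately show "p + q \<in> ?K" by (intro CollectI exI[of _ "\<lambda>k. a k + b k"]) simp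
qed

text \<open>\<open>f\<close> multiplies the monomial ideal of \<open>?V\<close> into its product
  with \<open>?I\<close>, since each exponent of \<open>f\<close> together with a point of
  \<open>?V\<close> can be traded for a point of \<open>G\<close> and another point of
  \<open>?V\<close>. On the generators \<open>ys\<close> this is a square linear system with a
  nonzero solution, which elimination turns into an integral equation.\<close>

lemma newton_subset_integral_closure:
  fixes f :: "'k::field poly2"
  assumes G: "finite G" and A: "A = {e. \<exists>p\<in>G. fst p \<le> fst e \<and> snd p \<le> snd e}"
    and f: "f \<in> mon_ideal (newton G 1)"
  shows "f \<in> ideal_integral_closure (mon_ideal A)"
proof -
  let ?I = "mon_ideal A :: 'k poly2 set" and ?V = "newton G (card G)"
  have upA: "up_closed A" unfolding A up_closed_def by (auto intro: trans_le_add1)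
  note I = mon_ideal_is_ideal[OF upA, where 'k = 'k]
  \<comment> \<open>With all coefficients equal to 1, the sum of the points of \<open>G\<close>
    shows that \<open>?V\<close> is nonempty, so a generator \<open>v 0\<close> exists.\<close>
  have "(\<Sum>a\<in>G. fst a, \<Sum>a\<in>G. snd a) \<in> ?V"
    unfolding newton_def by (intro CollectI exI[of _ "\<lambda>_. 1"]) auto
  then have "?V \<noteq> {}" by blast
  with up_closed_newton obtain ys where ys: "ys \<noteq> []"
    "?V = {e. \<exists>p\<in>set ys. fst p \<le> fst e \<and> snd p \<le> snd e}"
    by (rule staircase_exists)
  obtain n where n: "length ys = Suc n" using ys(1) by (cases ys) auto
  define v where "v k = (monom2 (ys ! k) :: 'k poly2)" for k
  let ?K = "{\<Sum>k<Suc n. b k * v k | b. \<forall>k<Suc n. b k \<in> ?I}"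
  have K: "is_ideal ?K" by (rule is_ideal_combinations[OF I])
  have "f * v j \<in> ?K" if j: "j < Suc n" for j
  proof -
    have mon: "monom2 e * v j \<in> ?K" if e: "e \<in> newton G 1" for e
    proof -
      have "ys ! j \<in> ?V" unfolding ys(2) using j n by auto
      with G e obtain a u where au: "a \<in> G" "u \<in> ?V" "e + ys ! j = a + u" by (rule newton_reduction)
      then obtain k where k: "k < Suc n" "fst (ys ! k) \<le> fst u" "snd (ys ! k) \<le> snd u"
        unfolding ys(2) n[symmetric] by (auto simp: in_set_conv_nth)
      define r where "r = u - ys ! k"
      have "u = r + ys ! k" using k by (simp add: r_def prod_eq_iff)
      then have "monom2 e * v j = monom2 (a + r) * v k"
        using au(3) by (simp add: v_def monom2_mult add.assoc)
      moreover define b where "b i = (if i = k then monom2 (a + r) else 0 :: 'k poly2)" for i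
      have "(\<Sum>i<Suc n. b i * v i) = (\<Sum>i<Suc n. if i = k then monom2 (a + r) * v k else 0)"
        by (rule sum.cong) (auto simp: b_def)
      then have "(\<Sum>i<Suc n. b i * v i) = monom2 (a + r) * v k" using k(1) by simp
      moreover have "a + r \<in> A" using au(1) by (auto simp: A intro!: bexI[of _ a])
      then have "\<forall>i<Suc n. b i \<in> ?I" using I by (auto simp: b_def is_ideal_def)
      ultimately show ?thesis by (intro CollectI exI[of _ b]) simp
    qed
    have "(\<Sum>e\<in>Poly_Mapping.keys f. Poly_Mapping.single e (Poly_Mapping.lookup f e) * v j) \<in> ?K"
    proof (rule is_ideal_sum[OF K])
      fix e assume "e \<in> Poly_Mapping.keys f"
      then have "monom2 e * v j \<in> ?K" using f by (intro mon) (auto simp: mon_ideal_def)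
      then have "Poly_Mapping.single 0 (Poly_Mapping.lookup f e) * (monom2 e * v j) \<in> ?K"
        using K unfolding is_ideal_def by blast
      also have "Poly_Mapping.single 0 (Poly_Mapping.lookup f e) * (monom2 e * v j)
        = Poly_Mapping.single e (Poly_Mapping.lookup f e) * v j"
        by (simp add: monom2_def mult_single flip: mult.assoc)
      finally show "Poly_Mapping.single e (Poly_Mapping.lookup f e) * v j \<in> ?K" .
    qed
    then show ?thesis unfolding sum_distrib_right[symmetric] poly_mapping_sum_single[symmetric] .
  qed
  then have "\<forall>j. \<exists>b. j < Suc n \<longrightarrow> f * v j = (\<Sum>k<Suc n. b k * v k) \<and> (\<forall>k<Suc n. b k \<in> ?I)" by blast
  then obtain b where b: "\<And>j. j < Suc n \<Longrightarrow> f * v j = (\<Sum>k<Suc n. b j k * v k)"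
    "\<And>j k. j < Suc n \<Longrightarrow> k < Suc n \<Longrightarrow> b j k \<in> ?I"
    by metis
  have L: "- p \<in> lower_terms ?I f 1" if "p \<in> ?I" for p
  proof -
    have "p * 1 \<in> ideal_power ?I 1"
      unfolding One_nat_def ideal_power.simps by (rule ideal_span_base) (use that in blast)
    then have "p \<in> lower_terms ?I f 1" using lower_terms_base[of 1 1 p ?I f] by simp
    then show ?thesis by (rule module.subspace_neg[OF module_mult is_ideal_lower_terms])
  qed
  \<comment> \<open>The matrix of f Id - b annihilates the vector \<open>v\<close>; the entries of b
    lie in \<open>?I\<close>, so it has the shape required by \<open>elimination\<close> with d =
    1.\<close>
  define D where "D i j = (if i = j then f else 0) - b i j" for i j
  have "\<exists>c E. E - f ^ c \<in> lower_terms ?I f c \<and> E * v 0 = 0"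
  proof (rule elimination[of n D v f 1])
    fix i assume i: "i < Suc n"
    have "(\<Sum>j<Suc n. D i j * v j) = (\<Sum>j<Suc n. (if j = i then f * v i else 0) - b i j * v j)"
      by (rule sum.cong) (auto simp: D_def left_diff_distrib)
    also have "\<dots> = f * v i - (\<Sum>j<Suc n. b i j * v j)" using i by (simp only: sum_subtractf) simp
    also have "\<dots> = 0" using b(1)[OF i] by simp
    finally show "(\<Sum>j<Suc n. D i j * v j) = 0" .
    show "D i i - f ^ 1 \<in> lower_terms ?I f 1" using L b(2)[OF i i] by (simp add: D_def)
    show "D i j \<in> lower_terms ?I f 1" if "j < Suc n" "i \<noteq> j" for j
      using L b(2)[OF i that(1)] that(2) by (simp add: D_def)
  qed
  \<comment> \<open>\<open>v 0\<close> is a monomial, so \<open>E * v 0 = 0\<close> forces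
    \<open>E = 0\<close>; the membership then concerns \<open>- (f ^ c)\<close>, and a change of
    sign gives \<open>f ^ c\<close>.\<close>
  then obtain c E where "E - f ^ c \<in> lower_terms ?I f c" "E = 0" by (auto simp: v_def)
  then have "- (- (f ^ c)) \<in> lower_terms ?I f c"
    using module.subspace_neg[OF module_mult is_ideal_lower_terms] by fastforce
  then show ?thesis using integral_of_power_in_lower_terms by simp
qed

theorem theorem3p4:
  fixes I :: "'k::field poly2 set"
  assumes "monomial_ideal I" and "I \<noteq> {0}"
  shows "ideal_regularity (ideal_integral_closure I) \<le> ideal_regularity I"
proof -
  obtain A where A: "up_closed A" "I = mon_ideal A" using assms(1) by (rule monomial_idealE)
  have "A \<noteq> {}" using assms(2) A(2) by (auto simp: mon_ideal_def)
  with A(1) obtain xs where xs: "xs \<noteq> []" "A = {e. \<exists>p\<in>set xs. fst p \<le> fst e \<and> snd p \<le> snd e}"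
    by (rule staircase_exists)
  let ?B = "newton (set xs) 1"
  have closure: "ideal_integral_closure I = mon_ideal ?B"
    unfolding A(2) using integral_closure_subset_newton[OF finite_set _ xs(2)]
      newton_subset_integral_closure[OF finite_set xs(2)] xs(1) by auto
  have "A \<subseteq> ?B"
  proof
    fix e assume "e \<in> A"
    then obtain p where "p \<in> set xs" "fst p \<le> fst e" "snd p \<le> snd e" using xs(2) by blast
    \<comment> \<open>Both points of the pair are taken to be \<open>p\<close>, with coefficients 1
      and 0.\<close>
    then have "e \<in> newton (set xs) (1 + 0)" by (intro newton_pair[of _ p p]) auto
    then show "e \<in> ?B" by simp
  qed
  moreover have "set xs \<subseteq> A" using xs(2) by blast
  moreover have "\<exists>a\<in>A. fst a \<le> fst e" "\<exists>a\<in>A. snd a \<le> snd e" if "e \<in> ?B" for e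
    using newton_fst[OF finite_set that] newton_snd[OF finite_set that] \<open>set xs \<subseteq> A\<close> by blast+
  ultimately show ?thesis
    unfolding closure unfolding A(2)
    using ideal_regularity_mon_ideal_mono[OF A(1) \<open>A \<noteq> {}\<close> up_closed_newton] by blast
qed

end
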